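(* The generating function of the even dimensional Clifford-Fourier kernels is \[ G_{\pi/2}(x,y,a)=\begin{pmatrix}0&1\end{pmatrix}e^{-A}\begin{pmatrix}1\\1\end{pmatrix} =\cos\!\Big(\sqrt{|x|^{2}|y|^{2}-((x,y)-a)^{2}}\Big)+\big(-yx-(x,y)+a\big)\frac{\sin\!\Big(\sqrt{|x|^{2}|y|^{2}-((x,y)-a)^{2}}\Big)}{\sqrt{|x|^{2}|y|^{2}-((x,y)-a)^{2}}}, \] where \[ A=(a-(x,y))\begin{pmatrix}1&0\\0&-1\end{pmatrix}+\begin{pmatrix}0&-xy\\ yx&0\end{pmatrix}. \]
   Context: Let $\mathcal{C}\ell_{0,m}$ be the Clifford algebra generated by an orthonormal basis $e_1,\dots,e_m$ of $\mathbb{R}^m$ with $e_ie_j+e_je_i=-2\delta_{ij}$; vectors $x=\sum_j x_je_j$, $y=\sum_j y_je_j$ are embedded in it, $xy$ and $yx$ denote Clifford products, $(x,y)=\sum_j x_jy_j=-\tfrac12(xy+yx)$ is the Euclidean inner product, $x\wedge y=\tfrac12(xy-yx)$, and $|x|$ is the Euclidean norm. Let $\Gamma_y=-\sum_{j<k}e_je_k(y_j\partial_{y_k}-y_k\partial_{y_j})$. The fractional Clifford-Fourier kernel is $K_m^p(x,y)=e^{ip\Gamma_y}e^{-i(x,y)}$, and the Clifford-Fourier kernel is $K_m(x,y)=K_m^{\pi/2}(x,y)$. The formal generating function for the even dimensional kernels is $G_{\pi/2}(x,y,a)=\sum_{m=2,4,6,\dots}\frac{K_m(x,y)\,a^{m/2-1}}{\Gamma(m/2)}$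 (formal in the sense that the kernels are recovered from derivatives in $a$; each kernel is regarded as a function of $(x,y)$, $|x||y|$ and $|x\wedge y|$, with $x\wedge y/|x\wedge y|$ acting as an imaginary unit). *)

theory Defs
  imports "HOL-Analysis.Analysis"
begin

text \<open>Complexified Clifford algebra Cl_{0,m}: an element is a function assigning
  to each finite set of indices B (the basis blade e_B, indices in {0..<m},
  increasingly ordered) a complex coefficient.  All constructions below are
  indexed by the dimension m and vanish on blades not contained in {0..<m}.\<close>

type_synonym cl = "nat set \<Rightarrow> complex"

definition blade_sign :: "nat set \<Rightarrow> nat set \<Rightarrow> complex" where
  "blade_sign A B =
     (-1) ^ card {(a, b). a \<in> A \<and> b \<in> B \<and> b < a} * (-1) ^ card (A \<inter> B)"

text \<open>Clifford product, using e_A e_B = blade_sign A B e_{A \<triangle> B}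
  (with e_j e_j = -1).\<close>
definition clmul :: "nat \<Rightarrow> cl \<Rightarrow> cl \<Rightarrow> cl" where
  "clmul m u v = (\<lambda>C. if C \<subseteq> {..<m}
       then (\<Sum>A\<in>Pow {..<m}. blade_sign A ((A - C) \<union> (C - A)) * u A * v ((A - C) \<union> (C - A)))
       else 0)"

definition clscal :: "complex \<Rightarrow> cl" where
  "clscal c = (\<lambda>C. if C = {} then c else 0)"

definition cladd :: "cl \<Rightarrow> cl \<Rightarrow> cl" where
  "cladd u v = (\<lambda>C. u C + v C)"

definition clsmult :: "complex \<Rightarrow> cl \<Rightarrow> cl" where
  "clsmult c u = (\<lambda>C. c * u C)"

definition clsum :: "('i \<Rightarrow> cl) \<Rightarrow> 'i set \<Rightarrow> cl" where
  "clsum f S = (\<lambda>C. \<Sum>i\<in>S. f i C)"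

definition cle :: "nat \<Rightarrow> cl" where
  "cle j = (\<lambda>C. if C = {j} then 1 else 0)"

definition clvec :: "nat \<Rightarrow> (nat \<Rightarrow> real) \<Rightarrow> cl" where
  "clvec m x = (\<lambda>C. if \<exists>j<m. C = {j} then complex_of_real (x (THE j. C = {j})) else 0)"

definition inner_m :: "nat \<Rightarrow> (nat \<Rightarrow> real) \<Rightarrow> (nat \<Rightarrow> real) \<Rightarrow> real" where
  "inner_m m x y = (\<Sum>j<m. x j * y j)"

definition norm_m :: "nat \<Rightarrow> (nat \<Rightarrow> real) \<Rightarrow> real" where
  "norm_m m x = sqrt (\<Sum>j<m. (x j)\<^sup>2)"

definition pd :: "nat \<Rightarrow> ((nat \<Rightarrow> real) \<Rightarrow> cl) \<Rightarrow> (nat \<Rightarrow> real) \<Rightarrow> cl" where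
  "pd k F y = (\<lambda>C. vector_derivative (\<lambda>t. F (y(k := t)) C) (at (y k)))"

definition GammaOp :: "nat \<Rightarrow> ((nat \<Rightarrow> real) \<Rightarrow> cl) \<Rightarrow> ((nat \<Rightarrow> real) \<Rightarrow> cl)" where
  "GammaOp m F = (\<lambda>y. clsmult (-1)
      (clsum (\<lambda>(j, k). clmul m (clmul m (cle j) (cle k))
           (\<lambda>C. complex_of_real (y j) * pd k F y C - complex_of_real (y k) * pd j F y C))
        {(j, k). j < k \<and> k < m}))"

text \<open>Fractional Clifford-Fourier kernel K_m^p(x,y) = e^{i p Gamma_y} e^{-i(x,y)},
  the operator exponential taken as its (pointwise convergent) power series.\<close>
definition CF_kernel_frac :: "nat \<Rightarrow> real \<Rightarrow> (nat \<Rightarrow> real) \<Rightarrow> (nat \<Rightarrow> real) \<Rightarrow> cl" where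
  "CF_kernel_frac m p x y = (\<lambda>C. \<Sum>n. (\<i> * complex_of_real p) ^ n / fact n *
      ((GammaOp m ^^ n) (\<lambda>y'. clscal (exp (- \<i> * complex_of_real (inner_m m x y')))) y C))"

definition CF_kernel :: "nat \<Rightarrow> (nat \<Rightarrow> real) \<Rightarrow> (nat \<Rightarrow> real) \<Rightarrow> cl" where
  "CF_kernel m x y = CF_kernel_frac m (pi / 2) x y"

text \<open>2x2 matrices with entries in the Clifford algebra (indices 0,1).\<close>
type_synonym clmat = "nat \<Rightarrow> nat \<Rightarrow> cl"

definition matmul :: "nat \<Rightarrow> clmat \<Rightarrow> clmat \<Rightarrow> clmat" where
  "matmul m P Q = (\<lambda>i j. clsum (\<lambda>l. clmul m (P i l) (Q l j)) {..<2})"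

primrec matpow :: "nat \<Rightarrow> clmat \<Rightarrow> nat \<Rightarrow> clmat" where
  "matpow m P 0 = (\<lambda>i j. if i = j then clscal 1 else clscal 0)"
| "matpow m P (Suc n) = matmul m (matpow m P n) P"

definition matexp :: "nat \<Rightarrow> clmat \<Rightarrow> clmat" where
  "matexp m P = (\<lambda>i j C. \<Sum>n. matpow m P n i j C / fact n)"

definition matA :: "nat \<Rightarrow> (nat \<Rightarrow> real) \<Rightarrow> (nat \<Rightarrow> real) \<Rightarrow> real \<Rightarrow> clmat" where
  "matA m x y a = (\<lambda>i j.
     if i = 0 \<and> j = 0 then clscal (complex_of_real (a - inner_m m x y))
     else if i = 1 \<and> j = 1 then clscal (- complex_of_real (a - inner_m m x y))
     else if i = 0 \<and> j = 1 then clsmult (-1) (clmul m (clvec m x) (clvec m y))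
     else if i = 1 \<and> j = 0 then clmul m (clvec m y) (clvec m x)
     else clscal 0)"

definition G_matrix_form :: "nat \<Rightarrow> (nat \<Rightarrow> real) \<Rightarrow> (nat \<Rightarrow> real) \<Rightarrow> real \<Rightarrow> cl" where
  "G_matrix_form m x y a =
     (let E = matexp m (\<lambda>i j. clsmult (-1) (matA m x y a i j)) in cladd (E 1 0) (E 1 1))"

text \<open>The entire functions cos(sqrt t) and sin(sqrt t)/sqrt t of a real t
  (for t < 0 they become cosh(sqrt(-t)) and sinh(sqrt(-t))/sqrt(-t); value 1 at t = 0).\<close>
definition cos_sqrt :: "real \<Rightarrow> real" where
  "cos_sqrt t = (if t \<ge> 0 then cos (sqrt t) else cosh (sqrt (- t)))"

definition sinc_sqrt :: "real \<Rightarrow> real" where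
  "sinc_sqrt t = (if t > 0 then sin (sqrt t) / sqrt t
                  else if t = 0 then 1 else sinh (sqrt (- t)) / sqrt (- t))"

definition G_closed_form :: "nat \<Rightarrow> (nat \<Rightarrow> real) \<Rightarrow> (nat \<Rightarrow> real) \<Rightarrow> real \<Rightarrow> cl" where
  "G_closed_form m x y a =
     (let t = (norm_m m x)\<^sup>2 * (norm_m m y)\<^sup>2 - (inner_m m x y - a)\<^sup>2 in
      cladd (clscal (complex_of_real (cos_sqrt t)))
        (clsmult (complex_of_real (sinc_sqrt t))
           (cladd (clsmult (-1) (clmul m (clvec m y) (clvec m x)))
                  (clscal (complex_of_real (a - inner_m m x y))))))"

fun clderiv_n :: "nat \<Rightarrow> (real \<Rightarrow> cl) \<Rightarrow> real \<Rightarrow> cl" where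
  "clderiv_n 0 F = F"
| "clderiv_n (Suc n) F = (\<lambda>a C. vector_derivative (\<lambda>b. clderiv_n n F b C) (at a))"

end

theory Submission
  imports Defs "HOL-Complex_Analysis.Complex_Analysis"
begin

text \<open>Put \<open>s = (x,y)\<close>, \<open>q = |x|\<^sup>2 |y|\<^sup>2\<close> and \<open>w = x \<and> y = - yx - s\<close>, so that \<open>w\<^sup>2 = - (q - s\<^sup>2)\<close>.
  On functions \<open>f(q,s) + g(q,s) w\<close> the operator \<open>\<Gamma>\<^sub>y\<close> acts by
  \<open>D\<^sub>m (f, g) = ((m - 1) s g - (q - s\<^sup>2) g', f' + (m - 2) g)\<close>, with primes for the derivative in \<open>s\<close>.
  For \<open>m = 2\<close> one finds explicitly \<open>e\<^bsup>ip\<Gamma>\<^esup> e\<^bsup>-is\<^esup> = exp(- i s cos p + w sin p)\<close>.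
  The map \<open>T (f, g) = (f' - g, g')\<close> satisfies \<open>D\<^sub>m\<^sub>+\<^sub>2 T = T (D\<^sub>m + 1)\<close>, hence
  \<open>K\<^sub>m\<^sub>+\<^sub>2\<^sup>p = i e\<^bsup>ip\<^esup> T K\<^sub>m\<^sup>p\<close>; as these functions are entire in \<open>p\<close>, the exponential series is their
  Taylor series. At \<open>p = \<pi>/2\<close> the recursion is \<open>K\<^sub>m\<^sub>+\<^sub>2 = - T K\<^sub>m\<close>, which is also the effect of
  differentiating the closed form in \<open>a\<close>. The matrix form follows from
  \<open>A\<^sup>2 = - (q - (s - a)\<^sup>2) I\<close>.\<close>

section \<open>The Clifford product\<close>

text \<open>The two exponents count the pairs with b < a and those with b = a, so together they
  count the pairs with b \<le> a. The product form makes the sign multiplicative in each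
  blade.\<close>

lemma blade_sign_eq_prod:
  assumes "finite A" "finite B"
  shows "blade_sign A B = (\<Prod>a\<in>A. \<Prod>b\<in>B. if b \<le> a then -1 else 1)"
proof -
  let ?L = "{(a, b). a \<in> A \<and> b \<in> B \<and> b < a}"
  let ?D = "(\<lambda>a. (a, a)) ` (A \<inter> B)"
  have fin: "finite ?L" "finite ?D"
    using assms by (auto intro: finite_subset[of _ "A \<times> B"])
  have "(A \<times> B) \<inter> {z. snd z \<le> fst z} = ?L \<union> ?D"
    by (auto simp: le_less)
  moreover have "card (?L \<union> ?D) = card ?L + card (A \<inter> B)"
    using fin by (subst card_Un_disjoint) (auto simp: card_image inj_on_def)
  ultimately have "blade_sign A B = (\<Prod>z\<in>A \<times> B. if snd z \<le> fst z then -1 else 1)"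
    using assms by (simp add: blade_sign_def prod.If_cases power_add)
  then show ?thesis
    by (simp add: prod.cartesian_product case_prod_beta)
qed

text \<open>The factors over the intersection occur twice on the right and square to 1.\<close>

lemma prod_sym_diff_involution:
  fixes h :: "'a \<Rightarrow> 'b::comm_monoid_mult"
  assumes "finite A" "finite B" "\<And>a. h a * h a = 1"
  shows "prod h (sym_diff A B) = prod h A * prod h B"
proof -
  have "prod h A = prod h (A - B) * prod h (A \<inter> B)"
    using assms by (subst prod.union_disjoint[symmetric]) (auto intro: prod.cong simp: Un_Diff_Int)
  moreover have "prod h B = prod h (B - A) * prod h (A \<inter> B)"
    using assms by (subst prod.union_disjoint[symmetric]) (auto intro: prod.cong)
  moreover have "prod h (A \<inter> B) * prod h (A \<inter> B) = 1"
    using assms by (simp add: prod.distrib[symmetric])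
  moreover have "prod h (sym_diff A B) = prod h (A - B) * prod h (B - A)"
    using assms by (intro prod.union_disjoint) auto
  ultimately show ?thesis
    by (metis (no_types, lifting) mult.assoc mult.commute mult.right_neutral)
qed

lemma blade_sign_sym_diff_left:
  assumes "finite A" "finite B" "finite C"
  shows "blade_sign (sym_diff A B) C = blade_sign A C * blade_sign B C"
proof -
  have "(\<Prod>b\<in>C. if b \<le> a then -1 else 1) * (\<Prod>b\<in>C. if b \<le> a then -1 else 1) = (1::complex)" for a :: nat
    unfolding prod.distrib[symmetric] by (intro prod.neutral) simp
  then show ?thesis
    using assms by (simp add: blade_sign_eq_prod prod_sym_diff_involution)
qed

lemma blade_sign_sym_diff_right:
  assumes "finite A" "finite B" "finite C"
  shows "blade_sign A (sym_diff B C) = blade_sign A B * blade_sign A C"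
proof -
  have "(if b \<le> a then -1 else 1) * (if b \<le> a then -1 else 1) = (1::complex)" for a b :: nat
    by simp
  then show ?thesis
    using assms by (simp add: blade_sign_eq_prod prod_sym_diff_involution prod.distrib)
qed

text \<open>Both sides expand into the same three pairwise signs. This 2-cocycle identity is what
  makes the twisted product over symmetric differences associative.\<close>

lemma blade_sign_cocycle:
  assumes "finite A" "finite B" "finite C"
  shows "blade_sign A B * blade_sign (sym_diff A B) C = blade_sign A (sym_diff B C) * blade_sign B C"
  using assms by (simp add: blade_sign_sym_diff_left blade_sign_sym_diff_right)

lemma sym_diff_cancel: "sym_diff A (sym_diff A B) = B"
  by auto

lemma clmul_assoc: "clmul m (clmul m u v) w = clmul m u (clmul m v w)"
proof
  fix C
  show "clmul m (clmul m u v) w C = clmul m u (clmul m v w) C"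
  proof (cases "C \<subseteq> {..<m}")
    case False
    then show ?thesis by (simp add: clmul_def)
  next
    case C: True
    let ?P = "Pow {..<m}"
    have sd: "sym_diff A B \<in> ?P" if "A \<in> ?P" "B \<in> ?P" for A B
      using that by auto
    have fin: "finite A" if "A \<in> ?P" for A
      using that finite_subset by auto
    have "clmul m (clmul m u v) w C =
        (\<Sum>B\<in>?P. \<Sum>A\<in>?P. blade_sign B (sym_diff B C) * blade_sign A (sym_diff A B)
           * u A * v (sym_diff A B) * w (sym_diff B C))"
      using C by (simp add: clmul_def sum_distrib_left sum_distrib_right mult_ac)
    also have "\<dots> = (\<Sum>A\<in>?P. \<Sum>B\<in>?P. blade_sign B (sym_diff B C) * blade_sign A (sym_diff A B)
           * u A * v (sym_diff A B) * w (sym_diff B C))"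
      by (rule sum.swap)
    \<comment> \<open>For fixed A the inner sum is reindexed by B to \<open>sym_diff A B\<close>, an
      involution of the power set.\<close>
    also have "\<dots> = (\<Sum>A\<in>?P. \<Sum>B\<in>?P. blade_sign A (sym_diff A C) * blade_sign B (sym_diff B (sym_diff A C))
           * u A * v B * w (sym_diff B (sym_diff A C)))"
    proof (rule sum.cong[OF refl])
      fix A assume A: "A \<in> ?P"
      show "(\<Sum>B\<in>?P. blade_sign B (sym_diff B C) * blade_sign A (sym_diff A B)
           * u A * v (sym_diff A B) * w (sym_diff B C)) =
         (\<Sum>B\<in>?P. blade_sign A (sym_diff A C) * blade_sign B (sym_diff B (sym_diff A C))
           * u A * v B * w (sym_diff B (sym_diff A C)))"
      proof -
        have "blade_sign A (sym_diff A C) * blade_sign (sym_diff A B) (sym_diff (sym_diff A B) (sym_diff A C))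
           * u A * v (sym_diff A B) * w (sym_diff (sym_diff A B) (sym_diff A C)) =
            blade_sign B (sym_diff B C) * blade_sign A (sym_diff A B)
           * u A * v (sym_diff A B) * w (sym_diff B C)" if B: "B \<in> ?P" for B
        proof -
          have e: "sym_diff (sym_diff A B) (sym_diff A C) = sym_diff B C" by auto
          have e2: "sym_diff (sym_diff A B) (sym_diff B C) = sym_diff A C" by auto
          \<comment> \<open>The cocycle identity for the three blades A, \<open>sym_diff A B\<close>
            and \<open>sym_diff B C\<close>.\<close>
          have "blade_sign A (sym_diff A B) * blade_sign (sym_diff A (sym_diff A B)) (sym_diff B C)
            = blade_sign A (sym_diff (sym_diff A B) (sym_diff B C)) * blade_sign (sym_diff A B) (sym_diff B C)"
            using A B C sd by (intro blade_sign_cocycle fin) auto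
          then show ?thesis
            unfolding e e2 sym_diff_cancel by (simp add: mult.commute[of "blade_sign B (sym_diff B C)"])
        qed
        then show ?thesis
          using A sd by (intro sum.reindex_bij_witness[where i = "sym_diff A" and j = "sym_diff A"])
            (simp_all only: sym_diff_cancel)
      qed
    qed
    also have "\<dots> = clmul m u (clmul m v w) C"
    proof -
      have "sym_diff A C \<subseteq> {..<m}" if "A \<in> ?P" for A
        using that C by auto
      then show ?thesis
        using C by (simp add: clmul_def sum_distrib_left sum_distrib_right mult_ac)
    qed
    finally show ?thesis .
  qed
qed

section \<open>Bilinearity and scalars\<close>

lemma clmul_cladd_left: "clmul m (cladd u v) w = cladd (clmul m u w) (clmul m v w)"
  by (auto simp: clmul_def cladd_def fun_eq_iff sum.distrib algebra_simps)

lemma clmul_cladd_right: "clmul m w (cladd u v) = cladd (clmul m w u) (clmul m w v)"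
  by (auto simp: clmul_def cladd_def fun_eq_iff sum.distrib algebra_simps)

lemma clmul_clsmult_left: "clmul m (clsmult c u) w = clsmult c (clmul m u w)"
  by (auto simp: clmul_def clsmult_def fun_eq_iff sum_distrib_left mult_ac)

lemma clmul_clsmult_right: "clmul m w (clsmult c u) = clsmult c (clmul m w u)"
  by (auto simp: clmul_def clsmult_def fun_eq_iff sum_distrib_left mult_ac)

lemma clmul_clsum_left: "clmul m (clsum f S) w = clsum (\<lambda>i. clmul m (f i) w) S"
proof
  fix C
  show "clmul m (clsum f S) w C = clsum (\<lambda>i. clmul m (f i) w) S C"
    by (simp add: clmul_def clsum_def sum_distrib_left sum_distrib_right sum.swap[of _ S])
qed

lemma clmul_clsum_right: "clmul m w (clsum f S) = clsum (\<lambda>i. clmul m w (f i)) S"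
proof
  fix C
  show "clmul m w (clsum f S) C = clsum (\<lambda>i. clmul m w (f i)) S C"
    by (simp add: clmul_def clsum_def sum_distrib_left sum_distrib_right sum.swap[of _ S])
qed

text \<open>The type \<open>cl\<close> also contains functions with coefficients on blades outside
  the index range. Products vanish there, so \<open>clscal 1\<close> acts as a unit only on
  supported elements.\<close>

definition cl_supported :: "nat \<Rightarrow> cl \<Rightarrow> bool" where
  "cl_supported m u \<longleftrightarrow> (\<forall>C. \<not> C \<subseteq> {..<m} \<longrightarrow> u C = 0)"

lemma cl_supported_clmul [simp]: "cl_supported m (clmul m u v)"
  by (simp add: cl_supported_def clmul_def)

lemma cl_supported_clscal [simp]: "cl_supported m (clscal c)"
  by (auto simp: cl_supported_def clscal_def)

lemma cl_supported_clsmult [simp]: "cl_supported m u \<Longrightarrow> cl_supported m (clsmult c u)"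
  by (auto simp: cl_supported_def clsmult_def)

lemma cl_supported_cladd [simp]: "cl_supported m u \<Longrightarrow> cl_supported m v \<Longrightarrow> cl_supported m (cladd u v)"
  by (auto simp: cl_supported_def cladd_def)

lemma cl_supported_clvec [simp]: "cl_supported m (clvec m x)"
  by (auto simp: cl_supported_def clvec_def)

lemma cl_supported_cle [simp]: "j < m \<Longrightarrow> cl_supported m (cle j)"
  by (auto simp: cl_supported_def cle_def)

lemma clmul_clscal_left:
  assumes "cl_supported m u" shows "clmul m (clscal c) u = clsmult c u"
proof
  fix C
  have "(\<Sum>A\<in>Pow {..<m}. blade_sign A (sym_diff A C) * clscal c A * u (sym_diff A C))
    = (\<Sum>A\<in>Pow {..<m}. if A = {} then c * u C else 0)"
    by (intro sum.cong refl) (auto simp: clscal_def blade_sign_def)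
  then show "clmul m (clscal c) u C = clsmult c u C"
    using assms by (auto simp: clmul_def clsmult_def cl_supported_def sum.delta)
qed

lemma clmul_clscal_right:
  assumes "cl_supported m u" shows "clmul m u (clscal c) = clsmult c u"
proof
  fix C
  have "(\<Sum>A\<in>Pow {..<m}. blade_sign A (sym_diff A C) * u A * clscal c (sym_diff A C))
    = (\<Sum>A\<in>Pow {..<m}. if A = C then c * u C else 0)"
    by (intro sum.cong refl) (auto simp: clscal_def blade_sign_def)
  then show "clmul m u (clscal c) C = clsmult c u C"
    using assms by (auto simp: clmul_def clsmult_def cl_supported_def sum.delta)
qed

section \<open>Products of basis vectors and of two vectors\<close>

lemma clmul_cle_cle:
  assumes "j < m" "k < m"
  shows "clmul m (cle j) (cle k) = clsmult (if k \<le> j then -1 else 1) (\<lambda>C. if C = sym_diff {j} {k} then 1 else 0)"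
proof
  fix C
  have eq: "sym_diff {j} C = {k} \<longleftrightarrow> C = sym_diff {j} {k}"
    using sym_diff_cancel[of "{j}" C] sym_diff_cancel[of "{j}" "{k}"] by metis
  have "(\<Sum>A\<in>Pow {..<m}. blade_sign A (sym_diff A C) * cle j A * cle k (sym_diff A C))
    = (\<Sum>A\<in>Pow {..<m}. if A = {j} then (if C = sym_diff {j} {k} then blade_sign {j} {k} else 0) else 0)"
    unfolding cle_def by (intro sum.cong refl) (simp add: eq, metis eq)
  also have "\<dots> = (if C = sym_diff {j} {k} then blade_sign {j} {k} else 0)"
    using assms by (simp add: sum.delta)
  finally show "clmul m (cle j) (cle k) C = clsmult (if k \<le> j then -1 else 1) (\<lambda>C. if C = sym_diff {j} {k} then 1 else 0) C"
    using assms by (auto simp: clmul_def clsmult_def blade_sign_eq_prod)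
qed

lemma clmul_cle_self: "j < m \<Longrightarrow> clmul m (cle j) (cle j) = clscal (-1)"
  by (auto simp: clmul_cle_cle clscal_def clsmult_def)

lemma clmul_cle_anticommute:
  assumes "j < m" "k < m" "j \<noteq> k"
  shows "clmul m (cle k) (cle j) = clsmult (-1) (clmul m (cle j) (cle k))"
proof -
  have "sym_diff {k} {j} = sym_diff {j} {k}" by auto
  then show ?thesis
    using assms by (simp add: clmul_cle_cle clsmult_def fun_eq_iff)
qed

lemma clvec_eq_clsum: "clvec m x = clsum (\<lambda>j. clsmult (complex_of_real (x j)) (cle j)) {..<m}"
proof
  fix C
  show "clvec m x C = clsum (\<lambda>j. clsmult (complex_of_real (x j)) (cle j)) {..<m} C"
  proof (cases "\<exists>j<m. C = {j}")
    case True
    then obtain j where "j < m" "C = {j}" by blast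
    then show ?thesis
      by (auto simp: clvec_def clsum_def clsmult_def cle_def if_distrib sum.delta' cong: if_cong)
  next
    case False
    then show ?thesis
      by (auto simp: clvec_def clsum_def clsmult_def cle_def intro!: sum.neutral)
  qed
qed

lemma sum_pairs_less_Suc:
  fixes h :: "nat \<times> nat \<Rightarrow> 'a::comm_monoid_add"
  shows "sum h {(j, k). j < k \<and> k < Suc n} = sum h {(j, k). j < k \<and> k < n} + (\<Sum>j<n. h (j, n))"
proof -
  have "{(j, k). j < k \<and> k < Suc n} = {(j, k). j < k \<and> k < n} \<union> (\<lambda>j. (j, n)) ` {..<n}"
    by (auto simp: less_Suc_eq)
  moreover have "finite {(j, k). j < k \<and> k < n}"
    by (rule finite_subset[of _ "{..<n} \<times> {..<n}"]) auto
  ultimately show ?thesis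
    by (simp add: sum.union_disjoint sum.reindex inj_on_def disjoint_iff image_iff)
qed

lemma sum_square_split:
  fixes h :: "nat \<Rightarrow> nat \<Rightarrow> complex"
  shows "(\<Sum>j<n. \<Sum>k<n. h j k) = (\<Sum>j<n. h j j) + (\<Sum>(j, k)\<in>{(j, k). j < k \<and> k < n}. h j k + h k j)"
  by (induction n) (simp_all add: sum_pairs_less_Suc sum.distrib algebra_simps)

text \<open>Each index lies in n - 1 pairs; this count is the origin of the factor m - 1 in
  \<open>Gamma_pair\<close>.\<close>

lemma sum_pairs_less_add:
  fixes h :: "nat \<Rightarrow> complex"
  shows "(\<Sum>(j, k)\<in>{(j, k). j < k \<and> k < n}. h j + h k) = (of_nat n - 1) * (\<Sum>j<n. h j)"
  by (induction n) (simp_all add: sum_pairs_less_Suc sum.distrib algebra_simps)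

lemma clmul_clvec:
  "clmul m (clvec m x) (clvec m y) C
     = (\<Sum>j<m. \<Sum>k<m. complex_of_real (x j * y k) * clmul m (cle j) (cle k) C)"
  unfolding clvec_eq_clsum clmul_clsum_left clmul_clsum_right clmul_clsmult_left clmul_clsmult_right
  by (subst sum.swap) (simp add: clsum_def clsmult_def sum_distrib_left mult_ac)

text \<open>The diagonal terms form the scalar because basis vectors square to -1; the terms for (j,
  k) and (k, j) merge by anticommutation.\<close>

lemma clmul_clvec_pairs:
  "clmul m (clvec m x) (clvec m y) C
     = clscal (- complex_of_real (inner_m m x y)) C
       + (\<Sum>(j, k)\<in>{(j, k). j < k \<and> k < m}. complex_of_real (x j * y k - x k * y j) * clmul m (cle j) (cle k) C)"
proof -
  have "(\<Sum>(j, k)\<in>{(j, k). j < k \<and> k < m}. complex_of_real (x j * y k) * clmul m (cle j) (cle k) C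
           + complex_of_real (x k * y j) * clmul m (cle k) (cle j) C)
     = (\<Sum>(j, k)\<in>{(j, k). j < k \<and> k < m}. complex_of_real (x j * y k - x k * y j) * clmul m (cle j) (cle k) C)"
  proof (intro sum.cong refl, clarify)
    fix j k assume "j < k" "k < m"
    then have "clmul m (cle k) (cle j) C = - clmul m (cle j) (cle k) C"
      using clmul_cle_anticommute[of j m k] by (simp add: clsmult_def)
    then show "complex_of_real (x j * y k) * clmul m (cle j) (cle k) C
           + complex_of_real (x k * y j) * clmul m (cle k) (cle j) C
         = complex_of_real (x j * y k - x k * y j) * clmul m (cle j) (cle k) C"
      by (simp add: algebra_simps)
  qed
  moreover have "(\<Sum>j<m. complex_of_real (x j * y j) * clmul m (cle j) (cle j) C)
      = clscal (- complex_of_real (inner_m m x y)) C"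
    by (simp add: clmul_cle_self clscal_def inner_m_def sum_negf)
  ultimately show ?thesis
    unfolding clmul_clvec by (subst sum_square_split) simp
qed

lemma inner_m_commute: "inner_m m x y = inner_m m y x"
  by (simp add: inner_m_def mult.commute)

text \<open>The pair part of \<open>clmul_clvec_pairs\<close> is antisymmetric in x and y and
  cancels.\<close>

lemma clmul_clvec_anticommutator:
  "clmul m (clvec m x) (clvec m y) C + clmul m (clvec m y) (clvec m x) C
     = clscal (- 2 * complex_of_real (inner_m m x y)) C"
proof -
  have "(\<Sum>(j, k)\<in>{(j, k). j < k \<and> k < m}. complex_of_real (x j * y k - x k * y j) * clmul m (cle j) (cle k) C)
     + (\<Sum>(j, k)\<in>{(j, k). j < k \<and> k < m}. complex_of_real (y j * x k - y k * x j) * clmul m (cle j) (cle k) C) = 0"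
    unfolding sum.distrib[symmetric] by (intro sum.neutral) (auto simp: algebra_simps)
  then show ?thesis
    by (simp add: clmul_clvec_pairs inner_m_commute[of m y x] clscal_def)
qed

lemma norm_m_power2: "(norm_m m x)\<^sup>2 = inner_m m x x"
  by (simp add: norm_m_def inner_m_def power2_eq_square sum_nonneg)

lemma clmul_clvec_self: "clmul m (clvec m x) (clvec m x) = clscal (- complex_of_real (inner_m m x x))"
proof
  fix C
  have "2 * clmul m (clvec m x) (clvec m x) C = 2 * clscal (- complex_of_real (inner_m m x x)) C"
    using clmul_clvec_anticommutator[of m x x C] by (simp add: clscal_def)
  then show "clmul m (clvec m x) (clvec m x) C = clscal (- complex_of_real (inner_m m x x)) C"
    by simp
qed

lemma clmul_clvec_self_left:
  "cl_supported m u \<Longrightarrow> clmul m (clvec m x) (clmul m (clvec m x) u) = clsmult (- complex_of_real (inner_m m x x)) u"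
  by (simp add: clmul_assoc[symmetric] clmul_clvec_self clmul_clscal_left)

text \<open>The inner yy is the scalar -|y|^2 and can be pulled out, leaving xx = -|x|^2. Needed for
  the diagonal of the square of \<open>matA\<close>.\<close>

lemma clmul_xy_yx:
  "clmul m (clmul m (clvec m x) (clvec m y)) (clmul m (clvec m y) (clvec m x))
     = clscal (complex_of_real (inner_m m x x * inner_m m y y))"
  by (simp add: clmul_assoc clmul_clvec_self_left clmul_clsmult_right clmul_clvec_self)
    (simp add: clsmult_def clscal_def fun_eq_iff)

text \<open>Since xy = -yx - 2(x,y), this is (xy - yx)/2 written through yx, the shape that occurs
  in \<open>G_closed_form\<close>.\<close>

definition wedge :: "nat \<Rightarrow> (nat \<Rightarrow> real) \<Rightarrow> (nat \<Rightarrow> real) \<Rightarrow> cl" where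
  "wedge m x y = cladd (clsmult (-1) (clmul m (clvec m y) (clvec m x))) (clscal (- complex_of_real (inner_m m x y)))"

lemma wedge_pairs:
  "wedge m x y C = (\<Sum>(j, k)\<in>{(j, k). j < k \<and> k < m}. complex_of_real (x j * y k - x k * y j) * clmul m (cle j) (cle k) C)"
    (is "_ = ?S")
proof -
  have "clmul m (clvec m x) (clvec m y) C = clscal (- complex_of_real (inner_m m x y)) C + ?S"
    by (rule clmul_clvec_pairs)
  then have "?S = clmul m (clvec m x) (clvec m y) C - clscal (- complex_of_real (inner_m m x y)) C"
    by (simp only: add_diff_cancel_left')
  then show ?thesis
    using clmul_clvec_anticommutator[of m x y C]
    by (simp add: wedge_def cladd_def clsmult_def clscal_def algebra_simps split: if_splits)
qed

lemma cl_supported_wedge [simp]: "cl_supported m (wedge m x y)"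
  by (simp add: wedge_def)

text \<open>Replacing the inner xy of y(xy)x by -yx - 2(x,y) gives yxyx = -|x|^2 |y|^2 - 2(x,y) yx;
  the terms in yx then cancel in the square of yx + (x,y).\<close>

lemma wedge_square:
  "clmul m (wedge m x y) (wedge m x y)
     = clscal (- complex_of_real (inner_m m x x * inner_m m y y - (inner_m m x y)\<^sup>2))"
proof -
  let ?x = "clvec m x" and ?y = "clvec m y" and ?s = "complex_of_real (inner_m m x y)"
  have "clmul m ?x ?y = cladd (clsmult (-1) (clmul m ?y ?x)) (clscal (- 2 * ?s))"
    using clmul_clvec_anticommutator[of m x y] by (auto simp: fun_eq_iff cladd_def clsmult_def algebra_simps)
  then have "clmul m (clmul m ?y ?x) (clmul m ?y ?x)
      = clmul m ?y (clmul m (cladd (clsmult (-1) (clmul m ?y ?x)) (clscal (- 2 * ?s))) ?x)"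
    by (metis clmul_assoc)
  also have "\<dots> = cladd (clscal (- complex_of_real (inner_m m x x * inner_m m y y))) (clsmult (- 2 * ?s) (clmul m ?y ?x))"
    by (simp add: clmul_cladd_left clmul_cladd_right clmul_clsmult_left clmul_clsmult_right clmul_clscal_left
        clmul_assoc clmul_clvec_self clmul_clvec_self_left)
       (simp add: clmul_clscal_left clmul_clscal_right cladd_def clsmult_def clscal_def fun_eq_iff)
  finally have yxyx: "clmul m (clmul m ?y ?x) (clmul m ?y ?x)
      = cladd (clscal (- complex_of_real (inner_m m x x * inner_m m y y))) (clsmult (- 2 * ?s) (clmul m ?y ?x))" .
  show ?thesis
    unfolding wedge_def
    by (simp add: clmul_cladd_left clmul_cladd_right clmul_clsmult_left clmul_clsmult_right yxyx
        clmul_clscal_left clmul_clscal_right)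
      (simp add: cladd_def clsmult_def clscal_def fun_eq_iff power2_eq_square algebra_simps)
qed

section \<open>Entire functions of three variables\<close>

text \<open>A class of entire functions generated by closure rules. Differentiability, commuting
  partial derivatives and the chain rule all follow by rule induction, without a theory of several
  complex variables.\<close>

inductive entire3 :: "((nat \<Rightarrow> complex) \<Rightarrow> complex) \<Rightarrow> bool" where
  entire3_const: "entire3 (\<lambda>v. c)"
| entire3_var: "i < 3 \<Longrightarrow> entire3 (\<lambda>v. v i)"
| entire3_add: "entire3 F \<Longrightarrow> entire3 G \<Longrightarrow> entire3 (\<lambda>v. F v + G v)"
| entire3_mult: "entire3 F \<Longrightarrow> entire3 G \<Longrightarrow> entire3 (\<lambda>v. F v * G v)"
| entire3_comp: "\<phi> holomorphic_on UNIV \<Longrightarrow> entire3 F \<Longrightarrow> entire3 (\<lambda>v. \<phi> (F v))"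

declare entire3_const [simp] entire3_var [simp] entire3_add [simp] entire3_mult [simp]

lemma entire3_uminus [simp]: "entire3 F \<Longrightarrow> entire3 (\<lambda>v. - F v)"
  using entire3_mult[OF entire3_const[of "-1"], of F] by simp

lemma entire3_diff [simp]: "entire3 F \<Longrightarrow> entire3 G \<Longrightarrow> entire3 (\<lambda>v. F v - G v)"
  using entire3_add[of F "\<lambda>v. - G v"] by simp

lemma entire3_power [simp]: "entire3 F \<Longrightarrow> entire3 (\<lambda>v. F v ^ n)"
  by (induction n) simp_all

lemma entire3_exp [simp]: "entire3 F \<Longrightarrow> entire3 (\<lambda>v. exp (F v))"
  by (rule entire3_comp) (simp_all add: holomorphic_on_exp)

lemma entire3_sin [simp]: "entire3 F \<Longrightarrow> entire3 (\<lambda>v. sin (F v))"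
  by (rule entire3_comp) (simp_all add: holomorphic_on_sin)

lemma entire3_cos [simp]: "entire3 F \<Longrightarrow> entire3 (\<lambda>v. cos (F v))"
  by (rule entire3_comp) (simp_all add: holomorphic_on_cos)

lemma entire3_field_differentiable:
  "entire3 F \<Longrightarrow> (\<lambda>t. F (v(i := t))) field_differentiable (at t)"
proof (induction rule: entire3.induct)
  case (entire3_var j)
  then show ?case by (cases "i = j") simp_all
next
  case (entire3_comp \<phi> F)
  then have "\<phi> field_differentiable (at (F (v(i := t))))"
    by (simp add: holomorphic_on_def)
  from field_differentiable_compose[OF entire3_comp.IH this] show ?case
    by (simp only: o_def)
qed (auto intro!: field_differentiable_add field_differentiable_mult)

section \<open>Partial derivatives, chain rule and Taylor series\<close>

definition pdiff :: "nat \<Rightarrow> ((nat \<Rightarrow> complex) \<Rightarrow> complex) \<Rightarrow> (nat \<Rightarrow> complex) \<Rightarrow> complex" where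
  "pdiff i F v = deriv (\<lambda>t. F (v(i := t))) (v i)"

lemma entire3_has_pdiff:
  assumes "entire3 F"
  shows "((\<lambda>t. F (v(i := t))) has_field_derivative pdiff i F (v(i := t))) (at t)"
  using entire3_field_differentiable[OF assms, of v i t]
  by (simp add: pdiff_def DERIV_deriv_iff_field_differentiable)

lemma entire3_has_pdiff_at:
  assumes "entire3 F"
  shows "((\<lambda>t. F (v(i := t))) has_field_derivative pdiff i F v) (at (v i))"
  using entire3_has_pdiff[OF assms, of v i "v i"] by simp

lemma pdiff_eqI:
  "(\<And>v. ((\<lambda>t. F (v(i := t))) has_field_derivative G v) (at (v i))) \<Longrightarrow> pdiff i F = G"
  by (auto simp: pdiff_def fun_eq_iff intro: DERIV_imp_deriv)

lemma pdiff_const [simp]: "pdiff i (\<lambda>v. c) = (\<lambda>v. 0)"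
  by (rule pdiff_eqI) simp

lemma pdiff_var [simp]: "pdiff i (\<lambda>v. v j) = (\<lambda>v. if i = j then 1 else 0)"
  by (rule pdiff_eqI) (auto intro: derivative_eq_intros)

lemma pdiff_add [simp]:
  "entire3 F \<Longrightarrow> entire3 G \<Longrightarrow> pdiff i (\<lambda>v. F v + G v) = (\<lambda>v. pdiff i F v + pdiff i G v)"
  by (rule pdiff_eqI) (intro DERIV_add entire3_has_pdiff_at)

lemma pdiff_mult [simp]:
  "entire3 F \<Longrightarrow> entire3 G \<Longrightarrow> pdiff i (\<lambda>v. F v * G v) = (\<lambda>v. pdiff i F v * G v + F v * pdiff i G v)"
proof (rule pdiff_eqI)
  fix v assume "entire3 F" "entire3 G"
  from DERIV_mult[OF entire3_has_pdiff_at[OF this(1), of v i] entire3_has_pdiff_at[OF this(2), of v i]]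
  show "((\<lambda>t. F (v(i := t)) * G (v(i := t))) has_field_derivative pdiff i F v * G v + F v * pdiff i G v) (at (v i))"
    by (simp add: algebra_simps)
qed

lemma pdiff_comp:
  assumes "\<phi> holomorphic_on UNIV" "entire3 F"
  shows "pdiff i (\<lambda>v. \<phi> (F v)) = (\<lambda>v. deriv \<phi> (F v) * pdiff i F v)"
proof (rule pdiff_eqI)
  fix v
  have "(\<phi> has_field_derivative deriv \<phi> (F (v(i := v i)))) (at (F (v(i := v i))))"
    using assms(1) holomorphic_derivI[of \<phi> UNIV] by simp
  from DERIV_chain2[OF this entire3_has_pdiff_at[OF assms(2)]]
  show "((\<lambda>t. \<phi> (F (v(i := t)))) has_field_derivative deriv \<phi> (F v) * pdiff i F v) (at (v i))"
    by simp
qed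

lemma pdiff_uminus [simp]: "entire3 F \<Longrightarrow> pdiff i (\<lambda>v. - F v) = (\<lambda>v. - pdiff i F v)"
  using pdiff_mult[OF entire3_const[of "-1"], of F i] by simp

lemma pdiff_diff [simp]:
  "entire3 F \<Longrightarrow> entire3 G \<Longrightarrow> pdiff i (\<lambda>v. F v - G v) = (\<lambda>v. pdiff i F v - pdiff i G v)"
  using pdiff_add[of F "\<lambda>v. - G v" i] by simp

lemma pdiff_exp [simp]: "entire3 F \<Longrightarrow> pdiff i (\<lambda>v. exp (F v)) = (\<lambda>v. exp (F v) * pdiff i F v)"
  using pdiff_comp[of exp F i] by (simp add: holomorphic_on_exp DERIV_imp_deriv[OF DERIV_exp])

lemma pdiff_sin [simp]: "entire3 F \<Longrightarrow> pdiff i (\<lambda>v. sin (F v)) = (\<lambda>v. cos (F v) * pdiff i F v)"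
  using pdiff_comp[of sin F i] by (simp add: holomorphic_on_sin DERIV_imp_deriv[OF DERIV_sin])

lemma pdiff_cos [simp]: "entire3 F \<Longrightarrow> pdiff i (\<lambda>v. cos (F v)) = (\<lambda>v. - sin (F v) * pdiff i F v)"
  using pdiff_comp[of cos F i] by (simp add: holomorphic_on_cos DERIV_imp_deriv[OF DERIV_cos])

lemma entire3_pdiff [simp]: "entire3 F \<Longrightarrow> entire3 (pdiff i F)"
proof (induction rule: entire3.induct)
  case (entire3_comp \<phi> F)
  then have "deriv \<phi> holomorphic_on UNIV"
    by (simp add: holomorphic_deriv)
  with entire3_comp show ?case
    by (simp add: pdiff_comp entire3.entire3_comp[of "deriv \<phi>"])
qed simp_all

text \<open>Every differentiation rule is symmetric in i and j after two applications, so structural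
  induction replaces Schwarz's theorem.\<close>

lemma pdiff_commute: "entire3 F \<Longrightarrow> pdiff i (pdiff j F) = pdiff j (pdiff i F)"
proof (induction rule: entire3.induct)
  case (entire3_comp \<phi> F)
  then have "deriv \<phi> holomorphic_on UNIV"
    by (simp add: holomorphic_deriv)
  with entire3_comp show ?case
    by (simp add: pdiff_comp entire3.entire3_comp[of "deriv \<phi>"] fun_eq_iff)
qed (simp_all add: fun_eq_iff)

text \<open>The derivatives in \<open>pd\<close> and \<open>clderiv_n\<close> are real ones; this
  rule carries the complex partial derivatives over to curves with a real parameter.\<close>

lemma entire3_chain_rule:
  fixes \<gamma> :: "'a::real_normed_vector \<Rightarrow> nat \<Rightarrow> complex"
  assumes "entire3 F" and \<gamma>: "\<And>i. i < 3 \<Longrightarrow> ((\<lambda>t. \<gamma> t i) has_derivative \<gamma>' i) (at t)"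
  shows "((\<lambda>t. F (\<gamma> t)) has_derivative (\<lambda>h. \<Sum>i<3. \<gamma>' i h * pdiff i F (\<gamma> t))) (at t)"
  using assms(1)
proof (induction rule: entire3.induct)
  case (entire3_const c)
  then show ?case by simp
next
  case (entire3_var j)
  then have "(\<Sum>i<3. \<gamma>' i h * (if i = j then 1 else 0)) = \<gamma>' j h" for h
    by (simp add: if_distrib sum.delta cong: if_cong)
  with \<gamma>[OF entire3_var] show ?case by simp
next
  case (entire3_add F G)
  from has_derivative_add[OF entire3_add.IH] entire3_add.hyps show ?case
    by (simp add: algebra_simps sum.distrib)
next
  case (entire3_mult F G)
  from has_derivative_mult[OF entire3_mult.IH] entire3_mult.hyps show ?case
    by (simp add: algebra_simps sum.distrib sum_distrib_left sum_distrib_right)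
next
  case (entire3_comp \<phi> F)
  have "(\<phi> has_field_derivative deriv \<phi> (F (\<gamma> t))) (at (F (\<gamma> t)))"
    using entire3_comp.hyps holomorphic_derivI[of \<phi> UNIV] by simp
  from has_derivative_compose[OF entire3_comp.IH this[unfolded has_field_derivative_def]]
  show ?case
    using entire3_comp.hyps by (simp add: pdiff_comp sum_distrib_left mult_ac)
qed

text \<open>In one coordinate the function is entire, so its power series at 0 converges everywhere.
  Applied to the parameter p, this sums the operator exponential.\<close>

lemma entire3_taylor:
  assumes "entire3 F"
  shows "(\<lambda>n. (pdiff i ^^ n) F (v(i := 0)) / fact n * p ^ n) sums F (v(i := p))"
proof -
  let ?h = "\<lambda>t. F (v(i := t))"
  have entire3: "entire3 ((pdiff i ^^ n) F)" for n
    using assms by (induction n) simp_all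
  have "(deriv ^^ n) ?h = (\<lambda>t. (pdiff i ^^ n) F (v(i := t)))" for n
  proof (induction n)
    case (Suc n)
    have "(deriv ^^ Suc n) ?h = deriv (\<lambda>t. (pdiff i ^^ n) F (v(i := t)))"
      by (simp only: funpow.simps o_apply Suc)
    also have "\<dots> = (\<lambda>t. (pdiff i ^^ Suc n) F (v(i := t)))"
      using DERIV_imp_deriv[OF entire3_has_pdiff[OF entire3]] by (simp add: fun_eq_iff del: fun_upd_apply)
    finally show ?case .
  qed simp
  moreover have "?h holomorphic_on ball 0 (norm p + 1)"
    using entire3_field_differentiable[OF assms]
    by (auto simp: holomorphic_on_def intro: field_differentiable_at_within)
  ultimately show ?thesis
    using holomorphic_power_series[of ?h 0 "norm p + 1" p] by simp
qed

section \<open>The entire functions cos(sqrt t) and sin(sqrt t)/sqrt t, as power series free of any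
  branch of the root\<close>

definition cos_root :: "complex \<Rightarrow> complex" where
  "cos_root t = (\<Sum>n. (-1) ^ n / fact (2 * n) * t ^ n)"

definition sinc_root :: "complex \<Rightarrow> complex" where
  "sinc_root t = (\<Sum>n. (-1) ^ n / fact (2 * n + 1) * t ^ n)"

lemma summable_fact_bound:
  fixes c :: "nat \<Rightarrow> complex"
  assumes "\<And>n. norm (c n) \<le> 1 / fact n"
  shows "summable (\<lambda>n. c n * t ^ n)"
proof (rule summable_comparison_test'[OF summable_exp[of "norm t"]])
  fix n
  show "norm (c n * t ^ n) \<le> inverse (fact n) * norm t ^ n"
    using mult_right_mono[OF assms[of n], of "norm t ^ n"]
    by (simp add: norm_mult norm_power divide_inverse)
qed

lemma summable_cos_root: "summable (\<lambda>n. (-1) ^ n / fact (2 * n) * t ^ n :: complex)"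
  by (rule summable_fact_bound) (simp add: norm_divide norm_power divide_left_mono fact_mono)

lemma summable_sinc_root: "summable (\<lambda>n. (-1) ^ n / fact (2 * n + 1) * t ^ n :: complex)"
proof (rule summable_fact_bound)
  fix n
  have "(fact n :: real) \<le> fact (2 * n + 1)" by (intro fact_mono) simp
  then show "norm ((-1) ^ n / fact (2 * n + 1) :: complex) \<le> 1 / fact n"
    by (simp add: norm_divide norm_power divide_left_mono del: fact_Suc)
qed

lemma DERIV_cos_root: "(cos_root has_field_derivative - sinc_root t / 2) (at t)"
proof -
  have "diffs (\<lambda>n. (-1) ^ n / fact (2 * n)) n = - (1 / 2) * ((-1) ^ n / fact (2 * n + 1) :: complex)" for n
    by (simp add: diffs_def field_simps del: of_nat_Suc)
       (simp add: field_simps)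
  then have "(\<Sum>n. diffs (\<lambda>n. (-1) ^ n / fact (2 * n)) n * t ^ n) = - (1 / 2) * sinc_root t"
    unfolding sinc_root_def suminf_mult[OF summable_sinc_root, symmetric] by (simp only: mult.assoc)
  with termdiffs_strong_converges_everywhere[OF summable_cos_root, of t] show ?thesis
    by (simp add: cos_root_def[abs_def])
qed

lemma sinc_root_holomorphic: "sinc_root holomorphic_on UNIV"
  using termdiffs_strong_converges_everywhere[OF summable_sinc_root]
  by (auto simp: holomorphic_on_open sinc_root_def[abs_def])

lemma cos_root_holomorphic: "cos_root holomorphic_on UNIV"
  using DERIV_cos_root by (auto simp: holomorphic_on_open)

text \<open>A comparison of coefficients, using (2n + 1)! = (2n + 1) (2n)!. The form without
  division by t includes t = 0.\<close>

lemma deriv_sinc_root: "2 * t * deriv sinc_root t = cos_root t - sinc_root t"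
proof -
  let ?c = "\<lambda>n. (-1) ^ n / fact (2 * n + 1) :: complex"
  have d: "deriv sinc_root t = (\<Sum>n. diffs ?c n * t ^ n)"
    using termdiffs_strong_converges_everywhere[OF summable_sinc_root, of t]
    by (intro DERIV_imp_deriv) (simp add: sinc_root_def[abs_def])
  have "summable (\<lambda>n. diffs ?c n * t ^ n)"
    by (rule termdiff_converges_all) (rule summable_sinc_root)
  from diffs_equiv[OF this] have "(\<lambda>n. of_nat n * ?c n * t ^ (n - Suc 0)) sums deriv sinc_root t"
    by (simp add: d)
  \<comment> \<open>Multiplying by t restores the power t^n. At n = 0 the exponent is truncated to
    0, but the factor n makes the term vanish.\<close>
  from sums_mult[OF this, of "2 * t"]
  have "(\<lambda>n. 2 * of_nat n * ?c n * t ^ n) sums (2 * t * deriv sinc_root t)"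
  proof (rule sums_cong[THEN iffD1, rotated])
    fix n show "2 * t * (of_nat n * ?c n * t ^ (n - Suc 0)) = 2 * of_nat n * ?c n * t ^ n"
      by (cases n) (simp_all only: of_nat_0 mult_zero_left mult_zero_right power_Suc diff_Suc_Suc minus_nat.diff_0 mult_ac)
  qed
  moreover have "(\<lambda>n. ?c n * t ^ n) sums sinc_root t"
    unfolding sinc_root_def by (rule summable_sums[OF summable_sinc_root])
  ultimately have "(\<lambda>n. 2 * of_nat n * ?c n * t ^ n + ?c n * t ^ n) sums (2 * t * deriv sinc_root t + sinc_root t)"
    by (rule sums_add)
  moreover have "2 * of_nat n * ?c n * t ^ n + ?c n * t ^ n = (-1) ^ n / fact (2 * n) * t ^ n" for n
  proof -
    have "(2 * of_nat n + 1 :: complex) \<noteq> 0"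
      using of_nat_neq_0[of "2 * n", where 'a = complex] by (simp add: add.commute)
    moreover have "(fact (2 * n + 1) :: complex) = (2 * of_nat n + 1) * fact (2 * n)"
      by (simp add: algebra_simps)
    ultimately have "(2 * of_nat n + 1) * ?c n = (-1) ^ n / fact (2 * n)"
      by (simp only: times_divide_eq_right nonzero_mult_divide_mult_cancel_left not_False_eq_True)
    then show ?thesis by (metis distrib_right mult_1)
  qed
  moreover have "(\<lambda>n. (-1) ^ n / fact (2 * n) * t ^ n) sums cos_root t"
    unfolding cos_root_def by (rule summable_sums[OF summable_cos_root])
  ultimately have "2 * t * deriv sinc_root t + sinc_root t = cos_root t"
    using sums_unique2 by auto
  then show ?thesis by (simp add: algebra_simps)
qed

lemma cos_root_0 [simp]: "cos_root 0 = 1"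
  unfolding cos_root_def by (subst powser_zero) simp

text \<open>Grouping the cosine series in consecutive pairs removes the vanishing odd
  coefficients.\<close>

lemma cos_root_power2: "cos_root (z\<^sup>2) = cos z"
proof -
  have "(\<lambda>n. \<Sum>k = n * 2..<n * 2 + 2. cos_coeff k *\<^sub>R z ^ k) sums cos z"
    by (rule sums_group) (use cos_converges[of z] in auto)
  then have "(\<lambda>n. (-1) ^ n / fact (2 * n) * (z\<^sup>2) ^ n) sums cos z"
    by (simp add: cos_coeff_def scaleR_conv_of_real power_mult[symmetric] mult.commute)
  then show ?thesis by (simp add: cos_root_def sums_iff)
qed

lemma sinc_root_power2: "sinc_root (z\<^sup>2) * z = sin z"
proof -
  have "(\<lambda>n. \<Sum>k = n * 2..<n * 2 + 2. sin_coeff k *\<^sub>R z ^ k) sums sin z"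
    by (rule sums_group) (use sin_converges[of z] in auto)
  then have "(\<lambda>n. (-1) ^ n / fact (2 * n + 1) * (z\<^sup>2) ^ n * z) sums sin z"
    by (simp add: sin_coeff_def scaleR_conv_of_real power_mult[symmetric] mult_ac del: fact_Suc)
  then show ?thesis
    using sums_mult2[OF summable_sums[OF summable_sinc_root, of "z\<^sup>2"], of z]
    by (simp add: sinc_root_def sums_iff)
qed

lemma sinc_root_0: "sinc_root 0 = 1"
  unfolding sinc_root_def by (subst powser_zero) simp

lemma complex_cosh_eq_cos: "complex_of_real (cosh r) = cos (\<i> * complex_of_real r)"
  by (simp add: cos_exp_eq cosh_def exp_of_real[symmetric] scaleR_conv_of_real add.commute exp_minus)

lemma complex_sinh_eq_sin: "\<i> * complex_of_real (sinh r) = sin (\<i> * complex_of_real r)"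
  by (simp add: sin_exp_eq sinh_def exp_of_real[symmetric] scaleR_conv_of_real exp_minus field_simps)

text \<open>For t < 0 the number i sqrt(-t) squares to t and turns cosh into cos, so the real
  branches belong to one entire function.\<close>

lemma cos_sqrt_eq_cos_root: "complex_of_real (cos_sqrt t) = cos_root (complex_of_real t)"
proof (cases "t \<ge> 0")
  case True
  then show ?thesis
    using cos_root_power2[of "complex_of_real (sqrt t)"]
    by (simp add: cos_sqrt_def cos_of_real of_real_power[symmetric] del: of_real_power)
next
  case False
  then have "(\<i> * complex_of_real (sqrt (- t)))\<^sup>2 = complex_of_real t"
    by (simp add: power_mult_distrib of_real_power[symmetric] del: of_real_power)
  with False show ?thesis
    using cos_root_power2[of "\<i> * complex_of_real (sqrt (- t))"]
    by (simp add: cos_sqrt_def complex_cosh_eq_cos)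
qed

lemma sinc_sqrt_eq_sinc_root: "complex_of_real (sinc_sqrt t) = sinc_root (complex_of_real t)"
proof -
  consider "t > 0" | "t = 0" | "t < 0" by linarith
  then show ?thesis
  proof cases
    case 1
    then have "(complex_of_real (sqrt t))\<^sup>2 = complex_of_real t"
      by (simp add: of_real_power[symmetric] del: of_real_power)
    with 1 show ?thesis
      using sinc_root_power2[of "complex_of_real (sqrt t)"]
      by (simp add: sinc_sqrt_def sin_of_real field_simps)
  next
    case 2
    then show ?thesis by (simp add: sinc_sqrt_def sinc_root_0)
  next
    case 3
    then have "(\<i> * complex_of_real (sqrt (- t)))\<^sup>2 = complex_of_real t"
      by (simp add: power_mult_distrib of_real_power[symmetric] del: of_real_power)
    with 3 show ?thesis
      using sinc_root_power2[of "\<i> * complex_of_real (sqrt (- t))"]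
      by (simp add: sinc_sqrt_def complex_sinh_eq_sin[symmetric] field_simps)
  qed
qed

lemma entire3_cos_root [simp]: "entire3 F \<Longrightarrow> entire3 (\<lambda>v. cos_root (F v))"
  by (rule entire3_comp[OF cos_root_holomorphic])

lemma entire3_sinc_root [simp]: "entire3 F \<Longrightarrow> entire3 (\<lambda>v. sinc_root (F v))"
  by (rule entire3_comp[OF sinc_root_holomorphic])

lemma pdiff_cos_root [simp]: "entire3 F \<Longrightarrow> pdiff i (\<lambda>v. cos_root (F v)) = (\<lambda>v. - sinc_root (F v) / 2 * pdiff i F v)"
  using pdiff_comp[OF cos_root_holomorphic, of F i] by (simp add: DERIV_imp_deriv[OF DERIV_cos_root])

lemma pdiff_sinc_root [simp]: "entire3 F \<Longrightarrow> pdiff i (\<lambda>v. sinc_root (F v)) = (\<lambda>v. deriv sinc_root (F v) * pdiff i F v)"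
  by (rule pdiff_comp[OF sinc_root_holomorphic])

section \<open>The action of the angular operator on pairs\<close>

text \<open>In the functions below \<open>v 0\<close> is the parameter \<open>p\<close>, \<open>v 1\<close> is \<open>|x|\<^sup>2 |y|\<^sup>2\<close> and \<open>v 2\<close> is \<open>(x,y)\<close>;
  a pair \<open>(f, g)\<close> stands for \<open>f + g (x \<and> y)\<close>.\<close>

type_synonym fn_pair = "((nat \<Rightarrow> complex) \<Rightarrow> complex) \<times> ((nat \<Rightarrow> complex) \<Rightarrow> complex)"

text \<open>No derivative in \<open>v 1\<close> occurs, because the angular operator annihilates
  functions of |y|. The formula is justified by \<open>GammaOp_cl_of_pair\<close>.\<close>

definition Gamma_pair :: "nat \<Rightarrow> fn_pair \<Rightarrow> fn_pair" where
  "Gamma_pair m P = (\<lambda>v. (of_nat m - 1) * v 2 * snd P v - (v 1 - (v 2)\<^sup>2) * pdiff 2 (snd P) v,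
              \<lambda>v. pdiff 2 (fst P) v + (of_nat m - 2) * snd P v)"

text \<open>Index k stands for dimension 2k + 2. The base splits exp(- i s cos p + w sin p) into
  even and odd powers of w; the recursion is i e^(ip) T.\<close>

primrec kernel_pair :: "nat \<Rightarrow> fn_pair" where
  "kernel_pair 0 = (\<lambda>v. exp (- \<i> * v 2 * cos (v 0)) * cos_root ((sin (v 0))\<^sup>2 * (v 1 - (v 2)\<^sup>2)),
             \<lambda>v. exp (- \<i> * v 2 * cos (v 0)) * sin (v 0) * sinc_root ((sin (v 0))\<^sup>2 * (v 1 - (v 2)\<^sup>2)))"
| "kernel_pair (Suc k) = (\<lambda>v. \<i> * exp (\<i> * v 0) * (pdiff 2 (fst (kernel_pair k)) v - snd (kernel_pair k) v),
                   \<lambda>v. \<i> * exp (\<i> * v 0) * pdiff 2 (snd (kernel_pair k)) v)"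

lemma entire3_kernel_pair: "entire3 (fst (kernel_pair k))" "entire3 (snd (kernel_pair k))"
  by (induction k) simp_all

lemma entire3_Gamma_pair:
  assumes "entire3 (fst P)" "entire3 (snd P)"
  shows "entire3 (fst (Gamma_pair m P))" "entire3 (snd (Gamma_pair m P))"
  using assms by (simp_all add: Gamma_pair_def)

lemma pdiff_power2: "entire3 F \<Longrightarrow> pdiff i (\<lambda>v. (F v)\<^sup>2) = (\<lambda>v. 2 * F v * pdiff i F v)"
  by (simp add: power2_eq_square fun_eq_iff)

lemma kernel_pair_0_pdiff2_fst: "pdiff 2 (fst (kernel_pair 0)) v = - \<i> * cos (v 0) * fst (kernel_pair 0) v + v 2 * sin (v 0) * snd (kernel_pair 0) v"
proof -
  have "pdiff 2 (\<lambda>v. cos_root ((sin (v 0))\<^sup>2 * (v 1 - (v 2)\<^sup>2)))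
      = (\<lambda>v. (- sinc_root ((sin (v 0))\<^sup>2 * (v 1 - (v 2)\<^sup>2)) / 2) * ((sin (v 0))\<^sup>2 * (- 2 * v 2)))"
    by (simp add: pdiff_power2 fun_eq_iff algebra_simps)
  moreover have "pdiff 2 (\<lambda>v. cos (v 0)) = (\<lambda>v. 0)"
    by simp
  ultimately show ?thesis
    by (simp add: power2_eq_square algebra_simps)
qed

lemma kernel_pair_0_pdiff2_snd: "pdiff 2 (snd (kernel_pair 0)) v = - \<i> * cos (v 0) * snd (kernel_pair 0) v
   - 2 * v 2 * (sin (v 0))^3 * exp (- \<i> * v 2 * cos (v 0)) * deriv sinc_root ((sin (v 0))\<^sup>2 * (v 1 - (v 2)\<^sup>2))"
proof -
  have "pdiff 2 (\<lambda>v. sinc_root ((sin (v 0))\<^sup>2 * (v 1 - (v 2)\<^sup>2)))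
      = (\<lambda>v. deriv sinc_root ((sin (v 0))\<^sup>2 * (v 1 - (v 2)\<^sup>2)) * ((sin (v 0))\<^sup>2 * (- 2 * v 2)))"
    by (simp add: pdiff_power2 fun_eq_iff algebra_simps)
  moreover have "pdiff 2 (\<lambda>v. cos (v 0)) = (\<lambda>v. 0)" "pdiff 2 (\<lambda>v. sin (v 0)) = (\<lambda>v. 0)"
    by simp_all
  ultimately show ?thesis
    by (simp add: power2_eq_square power3_eq_cube algebra_simps)
qed

lemma kernel_pair_0_evolution:
  "pdiff 0 (fst (kernel_pair 0)) v = \<i> * fst (Gamma_pair 2 (kernel_pair 0)) v"
  "pdiff 0 (snd (kernel_pair 0)) v = \<i> * snd (Gamma_pair 2 (kernel_pair 0)) v"
proof -
  let ?S = "sin (v 0)" and ?C = "cos (v 0)" and ?q = "v 1 - (v 2)\<^sup>2" and ?E = "exp (- \<i> * v 2 * cos (v 0))"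
  let ?\<tau> = "?S\<^sup>2 * ?q"
  have e: "pdiff 0 (\<lambda>v. cos_root ((sin (v 0))\<^sup>2 * (v 1 - (v 2)\<^sup>2)))
      = (\<lambda>v. (- sinc_root ((sin (v 0))\<^sup>2 * (v 1 - (v 2)\<^sup>2)) / 2) * (2 * sin (v 0) * cos (v 0) * (v 1 - (v 2)\<^sup>2)))"
    by (simp add: pdiff_power2 fun_eq_iff algebra_simps)
  have s: "pdiff 0 (\<lambda>v. sinc_root ((sin (v 0))\<^sup>2 * (v 1 - (v 2)\<^sup>2)))
      = (\<lambda>v. deriv sinc_root ((sin (v 0))\<^sup>2 * (v 1 - (v 2)\<^sup>2)) * (2 * sin (v 0) * cos (v 0) * (v 1 - (v 2)\<^sup>2)))"
    by (simp add: pdiff_power2 fun_eq_iff algebra_simps)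
  have cs: "pdiff 0 (\<lambda>v. cos (v 0)) = (\<lambda>v. - sin (v 0))" "pdiff 0 (\<lambda>v. sin (v 0)) = (\<lambda>v. cos (v 0))"
    by simp_all
  define A where "A = ?E"
  define B where "B = cos_root ?\<tau>"
  define Z where "Z = sinc_root ?\<tau>"
  define Y where "Y = deriv sinc_root ?\<tau>"
  \<comment> \<open>Eliminating \<open>cos_root\<close> by the differential relation for
    \<open>sinc_root\<close> leaves polynomial identities in the abbreviated quantities.\<close>
  have rel: "B = Z + 2 * ?\<tau> * Y"
    using deriv_sinc_root[of ?\<tau>] by (simp add: B_def Z_def Y_def)
  have 1: "fst (kernel_pair 0) v = A * B" "snd (kernel_pair 0) v = A * ?S * Z"
    by (simp_all add: A_def B_def Z_def)
  have 2: "pdiff 2 (fst (kernel_pair 0)) v = - \<i> * ?C * (A * B) + v 2 * ?S * (A * ?S * Z)"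
    unfolding kernel_pair_0_pdiff2_fst 1 ..
  have 3: "pdiff 2 (snd (kernel_pair 0)) v = - \<i> * ?C * (A * ?S * Z) - 2 * v 2 * ?S ^ 3 * A * Y"
    unfolding kernel_pair_0_pdiff2_snd 1 A_def Y_def ..
  have 4: "pdiff 0 (fst (kernel_pair 0)) v = A * (\<i> * v 2 * ?S) * B - A * Z * ?S * ?C * ?q"
    using e by (simp add: cs A_def B_def Z_def algebra_simps)
  have 5: "pdiff 0 (snd (kernel_pair 0)) v = A * (\<i> * v 2 * ?S) * ?S * Z + A * ?C * Z + A * ?S * Y * (2 * ?S * ?C * ?q)"
    using s by (simp add: cs A_def Y_def Z_def algebra_simps)
  show "pdiff 0 (fst (kernel_pair 0)) v = \<i> * fst (Gamma_pair 2 (kernel_pair 0)) v"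
    unfolding Gamma_pair_def fst_conv 1 3 4 rel
    by (simp add: algebra_simps power2_eq_square power3_eq_cube)
  show "pdiff 0 (snd (kernel_pair 0)) v = \<i> * snd (Gamma_pair 2 (kernel_pair 0)) v"
    unfolding Gamma_pair_def snd_conv 1 2 5 rel
    by (simp add: algebra_simps power2_eq_square power3_eq_cube)
qed

text \<open>In the induction step the p-derivative of the factor e^(ip) supplies the summand 1 in
  the intertwining relation between T and the operators for m and m + 2; p- and s-derivatives
  commute.\<close>

lemma kernel_pair_evolution:
  "pdiff 0 (fst (kernel_pair k)) = (\<lambda>v. \<i> * fst (Gamma_pair (2 * k + 2) (kernel_pair k)) v) \<and>
   pdiff 0 (snd (kernel_pair k)) = (\<lambda>v. \<i> * snd (Gamma_pair (2 * k + 2) (kernel_pair k)) v)"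
proof (induction k)
  case 0
  show ?case using kernel_pair_0_evolution by (auto simp: fun_eq_iff numeral_2_eq_2)
next
  case (Suc k)
  define f where "f = fst (kernel_pair k)"
  define g where "g = snd (kernel_pair k)"
  have [simp]: "entire3 f" "entire3 g" by (simp_all add: f_def g_def entire3_kernel_pair)
  have U: "kernel_pair (Suc k) = (\<lambda>v. \<i> * exp (\<i> * v 0) * (pdiff 2 f v - g v), \<lambda>v. \<i> * exp (\<i> * v 0) * pdiff 2 g v)"
    by (simp add: f_def g_def)
  have f0: "pdiff 0 f = (\<lambda>v. \<i> * ((of_nat (2 * k + 2) - 1) * v 2 * g v - (v 1 - (v 2)\<^sup>2) * pdiff 2 g v))"
    and g0: "pdiff 0 g = (\<lambda>v. \<i> * (pdiff 2 f v + (of_nat (2 * k + 2) - 2) * g v))"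
    using Suc by (simp_all add: Gamma_pair_def f_def g_def)
  have f20: "pdiff 0 (pdiff 2 f) = pdiff 2 (pdiff 0 f)" and g20: "pdiff 0 (pdiff 2 g) = pdiff 2 (pdiff 0 g)"
    by (simp_all add: pdiff_commute)
  show ?case
    unfolding U Gamma_pair_def fst_conv snd_conv
    by (simp add: f20 g20) (simp add: f0 g0 pdiff_power2 fun_eq_iff algebra_simps power2_eq_square)
qed

text \<open>The coefficients of \<open>Gamma_pair\<close> are free of p, so it commutes with
  \<open>pdiff 0\<close> and maps solutions of the evolution equation to solutions.\<close>

lemma Gamma_pair_evolution:
  assumes "entire3 (fst P)" "entire3 (snd P)"
    and "pdiff 0 (fst P) = (\<lambda>v. \<i> * fst (Gamma_pair m P) v)" "pdiff 0 (snd P) = (\<lambda>v. \<i> * snd (Gamma_pair m P) v)"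
  shows "pdiff 0 (fst (Gamma_pair m P)) = (\<lambda>v. \<i> * fst (Gamma_pair m (Gamma_pair m P)) v)"
    and "pdiff 0 (snd (Gamma_pair m P)) = (\<lambda>v. \<i> * snd (Gamma_pair m (Gamma_pair m P)) v)"
proof -
  let ?Q = "Gamma_pair m P"
  note [simp] = assms(1,2) entire3_Gamma_pair[OF assms(1,2), of m]
  have "pdiff 0 (fst ?Q) = (\<lambda>v. (of_nat m - 1) * v 2 * pdiff 0 (snd P) v - (v 1 - (v 2)\<^sup>2) * pdiff 2 (pdiff 0 (snd P)) v)"
    by (simp add: Gamma_pair_def[of m P] pdiff_commute[of "snd P" 0 2] pdiff_power2)
  also have "\<dots> = (\<lambda>v. \<i> * fst (Gamma_pair m ?Q) v)"
    unfolding assms(4) Gamma_pair_def[of m ?Q] by (simp add: algebra_simps)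
  finally show "pdiff 0 (fst ?Q) = (\<lambda>v. \<i> * fst (Gamma_pair m ?Q) v)" .
  have "pdiff 0 (snd ?Q) = (\<lambda>v. pdiff 2 (pdiff 0 (fst P)) v + (of_nat m - 2) * pdiff 0 (snd P) v)"
    by (simp add: Gamma_pair_def[of m P] pdiff_commute[of "fst P" 0 2])
  also have "\<dots> = (\<lambda>v. \<i> * snd (Gamma_pair m ?Q) v)"
    unfolding assms(3,4) Gamma_pair_def[of m ?Q] by (simp add: algebra_simps)
  finally show "pdiff 0 (snd ?Q) = (\<lambda>v. \<i> * snd (Gamma_pair m ?Q) v)" .
qed

lemma pdiff_iterate_kernel_pair:
  defines "Q \<equiv> \<lambda>k n. (Gamma_pair (2 * k + 2) ^^ n) (kernel_pair k)"
  shows "(pdiff 0 ^^ n) (fst (kernel_pair k)) = (\<lambda>v. \<i> ^ n * fst (Q k n) v)"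
    and "(pdiff 0 ^^ n) (snd (kernel_pair k)) = (\<lambda>v. \<i> ^ n * snd (Q k n) v)"
proof -
  have *: "entire3 (fst (Q k n)) \<and> entire3 (snd (Q k n)) \<and>
     pdiff 0 (fst (Q k n)) = (\<lambda>v. \<i> * fst (Q k (Suc n)) v) \<and> pdiff 0 (snd (Q k n)) = (\<lambda>v. \<i> * snd (Q k (Suc n)) v)" for n
  proof (induction n)
    case 0
    then show ?case using kernel_pair_evolution[of k] by (simp add: Q_def entire3_kernel_pair)
  next
    case (Suc n)
    have "Q k (Suc n) = Gamma_pair (2 * k + 2) (Q k n)" for n by (simp add: Q_def)
    then show ?case using Suc entire3_Gamma_pair Gamma_pair_evolution by simp
  qed
  show "(pdiff 0 ^^ n) (fst (kernel_pair k)) = (\<lambda>v. \<i> ^ n * fst (Q k n) v)"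
    by (induction n) (simp_all add: * mult_ac, simp add: Q_def)
  show "(pdiff 0 ^^ n) (snd (kernel_pair k)) = (\<lambda>v. \<i> ^ n * snd (Q k n) v)"
    by (induction n) (simp_all add: * mult_ac, simp add: Q_def)
qed

section \<open>Initial value at p = 0 and expansion in p\<close>

definition plane_wave :: fn_pair where
  "plane_wave = (\<lambda>v. exp (- \<i> * v 2), \<lambda>v. 0)"

text \<open>Taylor coefficients at p = 0 see only this slice, and \<open>Gamma_pair\<close>, which
  does not differentiate in p, respects equality on it.\<close>

definition agree0 :: "fn_pair \<Rightarrow> fn_pair \<Rightarrow> bool" where
  "agree0 P Q \<longleftrightarrow> (\<forall>v. v 0 = 0 \<longrightarrow> fst P v = fst Q v \<and> snd P v = snd Q v)"

lemma agree0_pdiff2: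
  assumes "\<And>v. v 0 = 0 \<Longrightarrow> f v = g v" "v 0 = 0"
  shows "pdiff 2 f v = pdiff 2 g v"
  unfolding pdiff_def using assms by simp

lemma agree0_Gamma_pair: "agree0 P Q \<Longrightarrow> agree0 (Gamma_pair m P) (Gamma_pair m Q)"
  unfolding agree0_def Gamma_pair_def using agree0_pdiff2[of "fst P" "fst Q"] agree0_pdiff2[of "snd P" "snd Q"]
  by simp

text \<open>At p = 0 the recursion reproduces the plane wave: its s-derivative contributes -i, which
  cancels the prefactor i.\<close>

lemma agree0_kernel_pair: "agree0 (kernel_pair k) plane_wave"
proof (induction k)
  case 0
  then show ?case by (simp add: agree0_def plane_wave_def)
next
  case (Suc k)
  have "pdiff 2 (fst (kernel_pair k)) v = - \<i> * exp (- \<i> * v 2)" "pdiff 2 (snd (kernel_pair k)) v = 0" if "v 0 = 0" for v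
    using agree0_pdiff2[of "fst (kernel_pair k)" "fst plane_wave" v] agree0_pdiff2[of "snd (kernel_pair k)" "snd plane_wave" v]
      Suc that by (simp_all add: agree0_def plane_wave_def)
  with Suc show ?case by (simp add: agree0_def plane_wave_def)
qed

text \<open>By the evolution equation the n-th p-derivative is i^n times the n-th iterate of
  \<open>Gamma_pair\<close>; at p = 0 the kernel may be replaced by the plane wave.\<close>

lemma kernel_pair_taylor:
  fixes k v
  defines "Q \<equiv> \<lambda>n. (Gamma_pair (2 * k + 2) ^^ n) plane_wave"
  shows "(\<lambda>n. (\<i> * p) ^ n / fact n * fst (Q n) (v(0 := 0))) sums fst (kernel_pair k) (v(0 := p))"
    and "(\<lambda>n. (\<i> * p) ^ n / fact n * snd (Q n) (v(0 := 0))) sums snd (kernel_pair k) (v(0 := p))"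
proof -
  have "agree0 ((Gamma_pair (2 * k + 2) ^^ n) (kernel_pair k)) (Q n)" for n
    by (induction n) (simp_all add: Q_def agree0_kernel_pair agree0_Gamma_pair)
  then have "fst ((Gamma_pair (2 * k + 2) ^^ n) (kernel_pair k)) (v(0 := 0)) = fst (Q n) (v(0 := 0))"
    "snd ((Gamma_pair (2 * k + 2) ^^ n) (kernel_pair k)) (v(0 := 0)) = snd (Q n) (v(0 := 0))" for n
    by (simp_all add: agree0_def)
  with entire3_taylor[OF entire3_kernel_pair(1), of 0 k v p] entire3_taylor[OF entire3_kernel_pair(2), of 0 k v p]
  show "(\<lambda>n. (\<i> * p) ^ n / fact n * fst (Q n) (v(0 := 0))) sums fst (kernel_pair k) (v(0 := p))"
    "(\<lambda>n. (\<i> * p) ^ n / fact n * snd (Q n) (v(0 := 0))) sums snd (kernel_pair k) (v(0 := p))"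
    by (simp_all add: pdiff_iterate_kernel_pair power_mult_distrib mult_ac)
qed

lemma entire3_Gamma_pair_iterate:
  "entire3 (fst ((Gamma_pair m ^^ n) plane_wave))" "entire3 (snd ((Gamma_pair m ^^ n) plane_wave))"
proof (induction n)
  case 0
  { case 1 show ?case by (simp add: plane_wave_def) }
  { case 2 show ?case by (simp add: plane_wave_def) }
next
  case (Suc n)
  { case 1 show ?case using Suc by (simp add: entire3_Gamma_pair) }
  { case 2 show ?case using Suc by (simp add: entire3_Gamma_pair) }
qed

section \<open>The Clifford-Fourier kernel\<close>

definition coords :: "complex \<Rightarrow> complex \<Rightarrow> complex \<Rightarrow> nat \<Rightarrow> complex" where
  "coords p q s = (\<lambda>i. if i = 0 then p else if i = 1 then q else if i = 2 then s else 0)"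

lemma coords_simps [simp]: "coords p q s 0 = p" "coords p q s (Suc 0) = q" "coords p q s 2 = s"
  by (simp_all add: coords_def)

lemma coords_upd [simp]: "(coords p q s)(0 := p') = coords p' q s"
  by (auto simp: coords_def)

lemma sum_upto_3: "(\<Sum>i<3. h i) = h 0 + h 1 + h (2::nat)" for h :: "nat \<Rightarrow> complex"
  by (simp add: eval_nat_numeral)

text \<open>Used with a coordinate of y as the parameter t, and later with t = a.\<close>

lemma entire3_coords_vector_derivative:
  assumes "entire3 F" "(q has_real_derivative q') (at t)" "(s has_real_derivative s') (at t)"
  shows "((\<lambda>t. F (coords p (complex_of_real (q t)) (complex_of_real (s t)))) has_vector_derivative
      complex_of_real q' * pdiff 1 F (coords p (complex_of_real (q t)) (complex_of_real (s t)))
    + complex_of_real s' * pdiff 2 F (coords p (complex_of_real (q t)) (complex_of_real (s t)))) (at t)"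
proof -
  let ?\<gamma> = "\<lambda>t. coords p (complex_of_real (q t)) (complex_of_real (s t))"
  let ?\<gamma>' = "\<lambda>i h. if i = 0 then 0 else if i = 1 then complex_of_real (q' * h) else complex_of_real (s' * h)"
  have "((\<lambda>t. F (?\<gamma> t)) has_derivative (\<lambda>h. \<Sum>i<3. ?\<gamma>' i h * pdiff i F (?\<gamma> t))) (at t)"
  proof (rule entire3_chain_rule[OF assms(1)])
    fix i :: nat assume "i < 3"
    then have "i = 0 \<or> i = 1 \<or> i = 2" by auto
    then show "((\<lambda>t. ?\<gamma> t i) has_derivative ?\<gamma>' i) (at t)"
      using assms(2,3)[unfolded has_field_derivative_def, THEN has_derivative_of_real] by auto
  qed
  then show ?thesis
    by (simp add: has_vector_derivative_def sum_upto_3 scaleR_conv_of_real algebra_simps)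
qed

definition cl_of_pair :: "nat \<Rightarrow> (nat \<Rightarrow> real) \<Rightarrow> fn_pair \<Rightarrow> (nat \<Rightarrow> real) \<Rightarrow> cl" where
  "cl_of_pair m x P y = (let v = coords 0 (complex_of_real (inner_m m x x * inner_m m y y)) (complex_of_real (inner_m m x y))
     in cladd (clscal (fst P v)) (clsmult (snd P v) (wedge m x y)))"

lemma inner_m_upd:
  assumes "k < m"
  shows "inner_m m x (y(k := t)) = inner_m m x y + (t - y k) * x k"
proof -
  have "(\<Sum>j\<in>{..<m} - {k}. x j * (y(k := t)) j) = (\<Sum>j\<in>{..<m} - {k}. x j * y j)"
    by (intro sum.cong) auto
  with assms show ?thesis
    by (simp add: inner_m_def sum.remove[of "{..<m}" k] algebra_simps)
qed

lemma inner_m_upd_upd: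
  assumes "k < m"
  shows "inner_m m (y(k := t)) (y(k := t)) = inner_m m y y + 2 * (t - y k) * y k + (t - y k)\<^sup>2"
  using assms by (simp add: inner_m_upd inner_m_commute[of m "y(k := t)" y] algebra_simps power2_eq_square)

lemma clvec_upd:
  assumes "k < m"
  shows "clvec m (y(k := t)) = cladd (clvec m y) (clsmult (complex_of_real (t - y k)) (cle k))"
  using assms by (auto simp: clvec_def cladd_def clsmult_def cle_def fun_eq_iff)

text \<open>The bivector is affine in each coordinate of y, so its partial derivative is the
  coefficient of t.\<close>

lemma wedge_upd:
  assumes "k < m"
  shows "wedge m x (y(k := t)) C = wedge m x y C
    - complex_of_real (t - y k) * (clmul m (cle k) (clvec m x) C + clscal (complex_of_real (x k)) C)"
  using assms
  by (simp add: wedge_def inner_m_upd clvec_upd clmul_cladd_left clmul_clsmult_left)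
     (simp add: cladd_def clsmult_def clscal_def algebra_simps)

lemma pd_cl_of_pair:
  fixes x y :: "nat \<Rightarrow> real"
  assumes "k < m" "entire3 (fst P)" "entire3 (snd P)"
  defines "v \<equiv> coords 0 (complex_of_real (inner_m m x x * inner_m m y y)) (complex_of_real (inner_m m x y))"
  shows "pd k (cl_of_pair m x P) y C =
     clscal (2 * inner_m m x x * y k * pdiff 1 (fst P) v + x k * pdiff 2 (fst P) v) C
     + (2 * inner_m m x x * y k * pdiff 1 (snd P) v + x k * pdiff 2 (snd P) v) * wedge m x y C
     - snd P v * (clmul m (cle k) (clvec m x) C + clscal (x k) C)"
proof -
  let ?q = "\<lambda>t. inner_m m x x * inner_m m (y(k := t)) (y(k := t))"
  let ?s = "\<lambda>t. inner_m m x (y(k := t))"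
  let ?v = "\<lambda>t. coords 0 (complex_of_real (?q t)) (complex_of_real (?s t))"
  let ?\<delta> = "if C = {} then 1 else 0 :: complex"
  have q: "(?q has_real_derivative 2 * inner_m m x x * y k) (at (y k))"
    unfolding inner_m_upd_upd[OF assms(1)] by (auto intro!: derivative_eq_intros)
  have s: "(?s has_real_derivative x k) (at (y k))"
    unfolding inner_m_upd[OF assms(1)] by (auto intro!: derivative_eq_intros)
  have w: "((\<lambda>t. wedge m x (y(k := t)) C) has_vector_derivative
      - (clmul m (cle k) (clvec m x) C + clscal (complex_of_real (x k)) C)) (at (y k))"
    unfolding wedge_upd[OF assms(1)] by (auto intro!: derivative_eq_intros)
  have "((\<lambda>t. ?\<delta> * fst P (?v t) + snd P (?v t) * wedge m x (y(k := t)) C) has_vector_derivative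
     (?\<delta> * (complex_of_real (2 * inner_m m x x * y k) * pdiff 1 (fst P) (?v (y k)) + complex_of_real (x k) * pdiff 2 (fst P) (?v (y k)))
     + (snd P (?v (y k)) * (- (clmul m (cle k) (clvec m x) C + clscal (complex_of_real (x k)) C))
       + (complex_of_real (2 * inner_m m x x * y k) * pdiff 1 (snd P) (?v (y k)) + complex_of_real (x k) * pdiff 2 (snd P) (?v (y k)))
           * wedge m x (y(k := y k)) C))) (at (y k))"
    by (intro has_vector_derivative_add has_vector_derivative_mult has_vector_derivative_mult_right
        entire3_coords_vector_derivative assms q s w)
  moreover have "cl_of_pair m x P (y(k := t)) C = ?\<delta> * fst P (?v t) + snd P (?v t) * wedge m x (y(k := t)) C" for t
    by (simp add: cl_of_pair_def Let_def cladd_def clsmult_def clscal_def)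
  ultimately have "pd k (cl_of_pair m x P) y C =
     (?\<delta> * (complex_of_real (2 * inner_m m x x * y k) * pdiff 1 (fst P) (?v (y k)) + complex_of_real (x k) * pdiff 2 (fst P) (?v (y k)))
     + (snd P (?v (y k)) * (- (clmul m (cle k) (clvec m x) C + clscal (complex_of_real (x k)) C))
       + (complex_of_real (2 * inner_m m x x * y k) * pdiff 1 (snd P) (?v (y k)) + complex_of_real (x k) * pdiff 2 (snd P) (?v (y k)))
           * wedge m x (y(k := y k)) C))"
    by (simp only: pd_def vector_derivative_at)
  then show ?thesis
    unfolding fun_upd_triv v_def[symmetric] by (simp add: clscal_def algebra_simps)
qed

text \<open>These contractions treat the terms e_k x that arise when the bivector itself is
  differentiated.\<close>

lemma clmul_cle_cle_cle:
  assumes "j < m" "k < m" "j \<noteq> k" "cl_supported m u"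
  shows "clmul m (clmul m (cle j) (cle k)) (clmul m (cle k) u) = clsmult (-1) (clmul m (cle j) u)"
    and "clmul m (clmul m (cle j) (cle k)) (clmul m (cle j) u) = clmul m (cle k) u"
proof -
  have "clmul m (clmul m (cle j) (cle k)) (clmul m (cle k) u) = clmul m (clmul m (cle j) (clmul m (cle k) (cle k))) u"
    for j k by (simp add: clmul_assoc)
  then have *: "clmul m (clmul m (cle j) (cle k)) (clmul m (cle k) u) = clsmult (-1) (clmul m (cle j) u)"
    if "j < m" "k < m" for j k
    using that by (simp add: clmul_cle_self clmul_clscal_right clmul_clsmult_left)
  show "clmul m (clmul m (cle j) (cle k)) (clmul m (cle k) u) = clsmult (-1) (clmul m (cle j) u)"
    using assms * by blast
  show "clmul m (clmul m (cle j) (cle k)) (clmul m (cle j) u) = clmul m (cle k) u"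
    using assms(1-3) clmul_cle_anticommute[of k m j] *[of k j]
    by (simp add: clmul_clsmult_left) (simp add: clsmult_def)
qed

lemma clmul_clvec_left: "clmul m (clvec m y) u C = (\<Sum>j<m. complex_of_real (y j) * clmul m (cle j) u C)"
  by (simp add: clvec_eq_clsum clmul_clsum_left clmul_clsmult_left) (simp add: clsum_def clsmult_def)

lemma clmul_wedge_left:
  "clmul m (wedge m x y) u C
    = (\<Sum>(j, k)\<in>{(j, k). j < k \<and> k < m}. complex_of_real (x j * y k - x k * y j) * clmul m (clmul m (cle j) (cle k)) u C)"
proof -
  have "wedge m x y = clsum (\<lambda>z. clsmult (complex_of_real (x (fst z) * y (snd z) - x (snd z) * y (fst z)))
      (clmul m (cle (fst z)) (cle (snd z)))) {(j, k). j < k \<and> k < m}"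
    by (simp add: fun_eq_iff wedge_pairs clsum_def clsmult_def case_prod_beta)
  then show ?thesis
    by (simp add: clmul_clsum_left clmul_clsmult_left) (simp add: clsum_def clsmult_def case_prod_beta)
qed

text \<open>The sum over pairs becomes w V - (m - 1) g yx, with V as in the proof; substituting yx =
  - w - s and the scalar value of w^2 gives the new pair.\<close>

lemma GammaOp_cl_of_pair:
  assumes "entire3 (fst P)" "entire3 (snd P)"
  shows "GammaOp m (cl_of_pair m x P) = cl_of_pair m x (Gamma_pair m P)"
proof (intro ext)
  fix y C
  define q where "q = complex_of_real (inner_m m x x * inner_m m y y)"
  define s where "s = complex_of_real (inner_m m x y)"
  define v where "v = coords 0 q s"
  define g where "g = snd P v"
  define fs where "fs = pdiff 2 (fst P) v"
  define gs where "gs = pdiff 2 (snd P) v"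
  let ?w = "wedge m x y" and ?x = "clvec m x"
  \<comment> \<open>V collects the factors of \<open>x j * y k - x k * y j\<close>: the
    s-derivatives of both components, and -g from the scalar term in the derivative of the
    bivector.\<close>
  define V where "V = cladd (clscal (fs - g)) (clsmult gs ?w)"
  note pd = pd_cl_of_pair[OF _ assms, of _ m x y, folded q_def s_def, folded v_def, folded g_def fs_def gs_def]
  have summand: "clmul m (clmul m (cle j) (cle k))
           (\<lambda>C. complex_of_real (y j) * pd k (cl_of_pair m x P) y C - complex_of_real (y k) * pd j (cl_of_pair m x P) y C) C
        = - (complex_of_real (x j * y k - x k * y j) * clmul m (clmul m (cle j) (cle k)) V C)
          + g * (complex_of_real (y j) * clmul m (cle j) ?x C + complex_of_real (y k) * clmul m (cle k) ?x C)"
    if jk: "j < k" "k < m" for j k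
  proof -
    \<comment> \<open>The q-derivatives carry the factors \<open>y k\<close> and \<open>y j\<close>
      and cancel in the antisymmetric combination.\<close>
    have "(\<lambda>C. complex_of_real (y j) * pd k (cl_of_pair m x P) y C - complex_of_real (y k) * pd j (cl_of_pair m x P) y C)
      = cladd (clsmult (- complex_of_real (x j * y k - x k * y j)) V)
         (clsmult (- g) (cladd (clsmult (complex_of_real (y j)) (clmul m (cle k) ?x))
           (clsmult (- complex_of_real (y k)) (clmul m (cle j) ?x))))"
      using jk assms
      by (auto simp: fun_eq_iff pd cladd_def clsmult_def clscal_def V_def algebra_simps)
    then show ?thesis
      using jk by (simp add: clmul_cladd_right clmul_clsmult_right clmul_cle_cle_cle)
        (simp add: cladd_def clsmult_def algebra_simps)
  qed
  have "GammaOp m (cl_of_pair m x P) y C =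
      - (\<Sum>(j, k)\<in>{(j, k). j < k \<and> k < m}. clmul m (clmul m (cle j) (cle k))
           (\<lambda>C. complex_of_real (y j) * pd k (cl_of_pair m x P) y C - complex_of_real (y k) * pd j (cl_of_pair m x P) y C) C)"
    by (simp add: GammaOp_def clsmult_def clsum_def case_prod_beta)
  also have "\<dots> = - (\<Sum>(j, k)\<in>{(j, k). j < k \<and> k < m}.
        - (complex_of_real (x j * y k - x k * y j) * clmul m (clmul m (cle j) (cle k)) V C)
          + g * (complex_of_real (y j) * clmul m (cle j) ?x C + complex_of_real (y k) * clmul m (cle k) ?x C))"
    by (intro arg_cong[where f = uminus] sum.cong refl) (auto simp only: summand mem_Collect_eq split_beta fst_conv snd_conv prod.case)
  also have "\<dots> = clmul m ?w V C - g * ((of_nat m - 1) * clmul m (clvec m y) ?x C)"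
    unfolding clmul_wedge_left clmul_clvec_left[of m y ?x] sum_pairs_less_add[symmetric]
    by (simp add: sum.distrib sum_subtractf sum_distrib_left[symmetric] case_prod_beta)
  also have "clmul m ?w V C = (fs - g) * ?w C + gs * clscal (- (q - s\<^sup>2)) C"
    unfolding V_def clmul_cladd_right clmul_clsmult_right wedge_square
    by (simp add: clmul_clscal_right) (simp add: cladd_def clsmult_def clscal_def q_def s_def)
  also have "clmul m (clvec m y) ?x C = - ?w C - clscal s C"
    by (simp add: wedge_def cladd_def clsmult_def clscal_def s_def)
  also have "(fs - g) * ?w C + gs * clscal (- (q - s\<^sup>2)) C - g * ((of_nat m - 1) * (- ?w C - clscal s C))
      = cl_of_pair m x (Gamma_pair m P) y C"
    unfolding cl_of_pair_def Let_def q_def[symmetric] s_def[symmetric] v_def[symmetric]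
    by (simp add: cladd_def clsmult_def clscal_def Gamma_pair_def fs_def[symmetric] gs_def[symmetric] g_def[symmetric])
      (simp add: v_def algebra_simps)
  finally show "GammaOp m (cl_of_pair m x P) y C = cl_of_pair m x (Gamma_pair m P) y C" .
qed

lemma GammaOp_iterate_plane_wave:
  "(GammaOp m ^^ n) (\<lambda>y. clscal (exp (- \<i> * complex_of_real (inner_m m x y)))) = cl_of_pair m x ((Gamma_pair m ^^ n) plane_wave)"
proof (induction n)
  case 0
  show ?case by (auto simp: cl_of_pair_def plane_wave_def cladd_def clsmult_def fun_eq_iff)
next
  case (Suc n)
  then show ?case by (simp add: GammaOp_cl_of_pair entire3_Gamma_pair_iterate)
qed

text \<open>The exponential series defining the kernel is, in both components, the Taylor series of
  \<open>kernel_pair k\<close> in p.\<close>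

lemma CF_kernel_eq_kernel_pair:
  fixes m x y
  defines "v \<equiv> coords (complex_of_real (pi / 2)) (complex_of_real (inner_m m x x * inner_m m y y)) (complex_of_real (inner_m m x y))"
  assumes m: "m = 2 * k + 2"
  shows "CF_kernel m x y C = clscal (fst (kernel_pair k) v) C + snd (kernel_pair k) v * wedge m x y C"
proof -
  define u where "u = coords 0 (complex_of_real (inner_m m x x * inner_m m y y)) (complex_of_real (inner_m m x y))"
  let ?p = "complex_of_real (pi / 2)" and ?\<delta> = "if C = {} then 1 else 0 :: complex"
  have uv: "u(0 := 0) = u" "u(0 := ?p) = v" by (simp_all add: u_def v_def)
  have "(\<lambda>n. ?\<delta> * ((\<i> * ?p) ^ n / fact n * fst ((Gamma_pair m ^^ n) plane_wave) u)
      + (\<i> * ?p) ^ n / fact n * snd ((Gamma_pair m ^^ n) plane_wave) u * wedge m x y C)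
     sums (?\<delta> * fst (kernel_pair k) v + snd (kernel_pair k) v * wedge m x y C)"
    using kernel_pair_taylor[of ?p k u, folded m] unfolding uv
    by (intro sums_add sums_mult sums_mult2)
  moreover have "?\<delta> * ((\<i> * ?p) ^ n / fact n * fst ((Gamma_pair m ^^ n) plane_wave) u)
      + (\<i> * ?p) ^ n / fact n * snd ((Gamma_pair m ^^ n) plane_wave) u * wedge m x y C
     = (\<i> * ?p) ^ n / fact n * cl_of_pair m x ((Gamma_pair m ^^ n) plane_wave) y C" for n
    unfolding cl_of_pair_def Let_def u_def[symmetric] by (simp add: cladd_def clsmult_def clscal_def algebra_simps)
  ultimately have "CF_kernel m x y C = ?\<delta> * fst (kernel_pair k) v + snd (kernel_pair k) v * wedge m x y C"
    unfolding CF_kernel_def CF_kernel_frac_def GammaOp_iterate_plane_wave by (simp only: sums_iff)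
  then show ?thesis by (simp add: clscal_def)
qed

section \<open>Derivatives of the closed form in a\<close>

lemma G_closed_form_alt:
  fixes m x y a
  defines "t \<equiv> complex_of_real (inner_m m x x * inner_m m y y - (inner_m m x y - a)\<^sup>2)"
  shows "G_closed_form m x y a C = clscal (cos_root t) C + sinc_root t * (wedge m x y C + clscal (complex_of_real a) C)"
  unfolding G_closed_form_def Let_def norm_m_power2 cos_sqrt_eq_cos_root sinc_sqrt_eq_sinc_root t_def[symmetric]
  by (simp add: wedge_def cladd_def clsmult_def clscal_def algebra_simps)

text \<open>At p = pi/2 the base pair with s replaced by s - a is the closed form. Differentiating
  in a gives minus the s-derivative, plus g from the summand a; this is - T, and i e^(ip) = -1
  there.\<close>

lemma clderiv_n_G_closed_form:
  fixes m x y
  defines "v \<equiv> \<lambda>a. coords (complex_of_real (pi / 2)) (complex_of_real (inner_m m x x * inner_m m y y)) (complex_of_real (inner_m m x y - a))"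
  shows "clderiv_n n (G_closed_form m x y) a C
    = clscal (fst (kernel_pair n) (v a)) C + snd (kernel_pair n) (v a) * (wedge m x y C + clscal (complex_of_real a) C)"
proof (induction n arbitrary: a C)
  case 0
  have "cos (complex_of_real (pi / 2)) = 0" "sin (complex_of_real (pi / 2)) = 1"
    unfolding cos_of_real sin_of_real by simp_all
  then show ?case
    by (simp add: G_closed_form_alt v_def del: of_real_divide)
next
  case (Suc n)
  let ?\<delta> = "if C = {} then 1 else 0 :: complex"
  have d: "((\<lambda>a. F (v a)) has_vector_derivative - pdiff 2 F (v a)) (at a)" if "entire3 F" for F
  proof -
    have "((\<lambda>a. F (v a)) has_vector_derivative
        complex_of_real 0 * pdiff 1 F (v a) + complex_of_real (- 1) * pdiff 2 F (v a)) (at a)"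
      unfolding v_def by (rule entire3_coords_vector_derivative[OF that]) (auto intro!: derivative_eq_intros)
    then show ?thesis by simp
  qed
  have e: "exp (\<i> * v a 0) = \<i>"
    using exp_Euler[of "complex_of_real (pi / 2)"] unfolding cos_of_real sin_of_real by (simp add: v_def)
  have "((\<lambda>a. ?\<delta> * fst (kernel_pair n) (v a) + snd (kernel_pair n) (v a) * (wedge m x y C + ?\<delta> * complex_of_real a)) has_vector_derivative
      (?\<delta> * (- pdiff 2 (fst (kernel_pair n)) (v a)) + (snd (kernel_pair n) (v a) * (0 + ?\<delta> * 1)
        + (- pdiff 2 (snd (kernel_pair n)) (v a)) * (wedge m x y C + ?\<delta> * complex_of_real a)))) (at a)"
    by (intro has_vector_derivative_add has_vector_derivative_mult has_vector_derivative_mult_right d entire3_kernel_pair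
         has_vector_derivative_const) (auto intro!: derivative_eq_intros)
  moreover have "clderiv_n n (G_closed_form m x y) a C
     = ?\<delta> * fst (kernel_pair n) (v a) + snd (kernel_pair n) (v a) * (wedge m x y C + ?\<delta> * complex_of_real a)" for a
    unfolding Suc by (simp add: clscal_def)
  ultimately have eq: "clderiv_n (Suc n) (G_closed_form m x y) a C =
      (?\<delta> * (- pdiff 2 (fst (kernel_pair n)) (v a)) + (snd (kernel_pair n) (v a) * (0 + ?\<delta> * 1)
        + (- pdiff 2 (snd (kernel_pair n)) (v a)) * (wedge m x y C + ?\<delta> * complex_of_real a)))"
    by (simp only: clderiv_n.simps vector_derivative_at)
  show ?case
    unfolding eq by (simp add: e clscal_def algebra_simps)
qed

section \<open>The matrix exponential\<close>

lemma sums_even_odd: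
  fixes f :: "nat \<Rightarrow> complex"
  assumes "(\<lambda>n. f (2 * n)) sums a" "(\<lambda>n. f (2 * n + 1)) sums b"
  shows "f sums (a + b)"
proof -
  have "(\<lambda>n. if even n then f n else 0) sums a"
    using assms(1) sums_mono_reindex[of "\<lambda>n. 2 * n" "\<lambda>n. if even n then f n else 0" a]
    by (force simp: strict_mono_def image_iff elim: evenE)
  moreover have "(\<lambda>n. if odd n then f n else 0) sums b"
    using assms(2) sums_mono_reindex[of "\<lambda>n. 2 * n + 1" "\<lambda>n. if odd n then f n else 0" b]
    by (force simp: strict_mono_def image_iff elim: oddE)
  ultimately have "(\<lambda>n. (if even n then f n else 0) + (if odd n then f n else 0)) sums (a + b)"
    by (rule sums_add)
  moreover have "(if even n then f n else 0) + (if odd n then f n else 0) = f n" for n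
    by simp
  ultimately show ?thesis by simp
qed

text \<open>Even powers of M are (-t)^n times the identity and odd ones (-t)^n M, so the two halves
  of the exponential series are those of \<open>cos_root\<close> and
  \<open>sinc_root\<close>.\<close>

lemma matexp_of_scalar_square:
  assumes sq: "\<And>i j. i < 2 \<Longrightarrow> j < 2 \<Longrightarrow> matmul m M M i j = clscal (if i = j then - t else 0)"
    and supp: "\<And>i j. i < 2 \<Longrightarrow> j < 2 \<Longrightarrow> cl_supported m (M i j)"
    and ij: "i < 2" "j < 2"
  shows "matexp m M i j C = clscal (if i = j then cos_root t else 0) C + sinc_root t * M i j C"
proof -
  have two: "{..<2} = {0, 1::nat}" by auto
  have pow: "(\<forall>i<2. \<forall>j<2. matpow m M (2 * n) i j = clscal (if i = j then (- t) ^ n else 0)) \<and>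
      (\<forall>i<2. \<forall>j<2. matpow m M (2 * n + 1) i j = clsmult ((- t) ^ n) (M i j))" for n
  proof (induction n)
    case 0
    then show ?case
      by (auto simp: matmul_def two clsum_def clmul_clscal_left supp clsmult_def fun_eq_iff less_2_cases_iff)
  next
    case (Suc n)
    have even: "matpow m M (2 * Suc n) i j = clscal (if i = j then (- t) ^ Suc n else 0)" if "i < 2" "j < 2" for i j
    proof -
      have "matpow m M (2 * Suc n) i j = matmul m (matpow m M (2 * n + 1)) M i j"
        by simp
      also have "\<dots> = clsum (\<lambda>l. clmul m (clsmult ((- t) ^ n) (M i l)) (M l j)) {..<2}"
        using Suc that by (simp add: matmul_def clsum_def two del: matpow.simps)
      also have "\<dots> = clsmult ((- t) ^ n) (matmul m M M i j)"
        by (simp add: matmul_def clmul_clsmult_left) (simp add: clsum_def clsmult_def sum_distrib_left)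
      finally show ?thesis
        using sq[OF that] by (auto simp: clsmult_def clscal_def fun_eq_iff)
    qed
    have "matpow m M (2 * Suc n + 1) i j = clsmult ((- t) ^ Suc n) (M i j)" if "i < 2" "j < 2" for i j
    proof -
      have "matpow m M (2 * Suc n + 1) i j = matmul m (matpow m M (2 * Suc n)) M i j"
        by simp
      also have "\<dots> = clsum (\<lambda>l. clmul m (clscal (if i = l then (- t) ^ Suc n else 0)) (M l j)) {..<2}"
        using even that by (simp add: matmul_def clsum_def two del: mult_Suc_right power_Suc matpow.simps)
      also have "\<dots> = clsmult ((- t) ^ Suc n) (M i j)"
        using that supp by (auto simp: two clsum_def clmul_clscal_left clsmult_def fun_eq_iff less_2_cases_iff)
      finally show ?thesis .
    qed
    with even show ?case by blast
  qed
  have "(\<lambda>n. matpow m M n i j C / fact n) sums (clscal (if i = j then cos_root t else 0) C + sinc_root t * M i j C)"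
  proof (rule sums_even_odd)
    have "(\<lambda>n. clscal (if i = j then 1 else 0) C * ((-1) ^ n / fact (2 * n) * t ^ n)) sums
        (clscal (if i = j then 1 else 0) C * cos_root t)"
      unfolding cos_root_def by (intro sums_mult summable_sums summable_cos_root)
    then show "(\<lambda>n. matpow m M (2 * n) i j C / fact (2 * n)) sums clscal (if i = j then cos_root t else 0) C"
      using pow ij by (simp add: clscal_def power_minus[of t] split: if_splits)
    have "(\<lambda>n. (-1) ^ n / fact (2 * n + 1) * t ^ n * M i j C) sums (sinc_root t * M i j C)"
      unfolding sinc_root_def by (intro sums_mult2 summable_sums summable_sinc_root)
    moreover have "matpow m M (2 * n + 1) i j C / fact (2 * n + 1) = (-1) ^ n / fact (2 * n + 1) * t ^ n * M i j C" for n
      using pow[of n] ij by (simp add: clsmult_def power_minus[of t] del: matpow.simps fact_Suc)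
    ultimately show "(\<lambda>n. matpow m M (2 * n + 1) i j C / fact (2 * n + 1)) sums (sinc_root t * M i j C)"
      by (simp only:)
  qed
  then show ?thesis by (simp add: matexp_def sums_iff)
qed

text \<open>Off the diagonal the two products cancel because the diagonal entries are opposite
  scalars; on it, (a - (x,y))^2 meets -|x|^2 |y|^2 from \<open>clmul_xy_yx\<close>.\<close>

lemma matA_square:
  fixes m x y a
  defines "M \<equiv> \<lambda>i j. clsmult (-1) (matA m x y a i j)"
  assumes "i < 2" "j < 2"
  shows "matmul m M M i j =
    clscal (if i = j then - complex_of_real (inner_m m x x * inner_m m y y - (inner_m m x y - a)\<^sup>2) else 0)"
proof -
  have two: "{..<2} = {0, 1::nat}" by auto
  show ?thesis
    using assms(2,3)
    by (auto simp: less_2_cases_iff matmul_def two M_def matA_def clmul_clsmult_left clmul_clsmult_right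
        clmul_clscal_left clmul_clscal_right clmul_xy_yx clsum_def)
      (auto simp: fun_eq_iff clsmult_def clscal_def power2_eq_square algebra_simps)
qed

text \<open>The second row of -A has entries -yx and a - (x,y), whose sum is the factor of the sine
  term.\<close>

lemma G_matrix_form_eq_closed: "G_matrix_form m x y a = G_closed_form m x y a"
proof
  fix C
  let ?M = "\<lambda>i j. clsmult (-1) (matA m x y a i j)"
  have "cl_supported m (?M i j)" for i j by (simp add: matA_def)
  note exp = matexp_of_scalar_square[OF matA_square this]
  show "G_matrix_form m x y a C = G_closed_form m x y a C"
    by (simp add: G_matrix_form_def Let_def cladd_def exp G_closed_form_alt)
      (simp add: matA_def wedge_def cladd_def clsmult_def clscal_def algebra_simps)
qed

text \<open>The formal generating function is read coefficientwise: for each even m, the kernel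
  divided by Gamma(m/2) is the Taylor coefficient at a = 0 of order m/2 - 1.\<close>

theorem theorem7:
  fixes m :: nat and x y :: "nat \<Rightarrow> real"
  assumes "even m" and "m \<ge> 2"
  shows "(\<forall>a. G_matrix_form m x y a = G_closed_form m x y a)
       \<and> clsmult (inverse (complex_of_real (Gamma (real m / 2)))) (CF_kernel m x y)
           = clsmult (inverse (fact (m div 2 - 1))) (clderiv_n (m div 2 - 1) (G_matrix_form m x y) 0)
       \<and> clsmult (inverse (complex_of_real (Gamma (real m / 2)))) (CF_kernel m x y)
           = clsmult (inverse (fact (m div 2 - 1))) (clderiv_n (m div 2 - 1) (G_closed_form m x y) 0)"
proof -
  define k where "k = m div 2 - 1"
  have m: "m = 2 * k + 2" using assms by (auto simp: k_def)
  then have "real m / 2 = 1 + real k" by simp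
  then have Gamma: "complex_of_real (Gamma (real m / 2)) = fact k"
    by (simp only: Gamma_fact of_real_fact)
  \<comment> \<open>At a = 0 the shift \<open>clscal a\<close> vanishes, so the k-th derivative is
    the kernel itself, with no factorial; Gamma(k + 1) = k! matches the normalisations.\<close>
  have "clscal 0 = (\<lambda>C. 0)" by (simp add: clscal_def)
  then have kernel: "CF_kernel m x y = clderiv_n k (G_closed_form m x y) 0"
    by (simp add: fun_eq_iff CF_kernel_eq_kernel_pair[OF m] clderiv_n_G_closed_form)
  have "G_matrix_form m x y = G_closed_form m x y"
    by (simp add: fun_eq_iff G_matrix_form_eq_closed)
  then show ?thesis
    unfolding k_def[symmetric] Gamma kernel by simp
qed

end
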